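(* Let $r, s, u_0, u_1$ be integers with $r^2+4s \neq 0$, and let $u_n = r u_{n-1} + s u_{n-2}$ for $n \geq 2$. Let $\alpha,\beta$ be the roots of $x^2 - rx - s$ and put $a = \frac{u_0\beta - u_1}{\beta-\alpha}$, $b = \frac{u_1 - u_0\alpha}{\beta - \alpha}$, so that $u_n = a\alpha^n + b\beta^n$ for all $n\ge 0$. Suppose the sequence is non-degenerate, i.e. $ab\alpha\beta \neq 0$ and $\alpha/\beta$ is not a root of unity. Let $\epsilon > 0$. Then there exists an effectively computable positive number $C$, depending on $\epsilon, a, b, \alpha, \beta$, such that for every integer $N > C$, $$\omega\Big(\prod_{\substack{n=1\\ u_n \neq 0}}^N u_n\Big) > \big(1 - 1/\sqrt{2} - \epsilon\big) N.$$
   Context: For a nonzero integer $m$, $\omega(m)$ denotes the number of distinct prime factors of $m$. *)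

theory Defs
  imports Complex_Main "HOL-Computational_Algebra.Primes" "HOL-Library.Nat_Bijection"
begin

definition omega :: "int \<Rightarrow> nat" where
  "omega m = card (prime_factors m)"

text \<open>
  Non-degeneracy of the sequence with general term
  \<open>a * \<alpha> ^ n + b * \<beta> ^ n\<close>.
\<close>

definition nondegenerate :: "complex \<Rightarrow> complex \<Rightarrow> complex \<Rightarrow> complex \<Rightarrow> bool" where
  "nondegenerate a b \<alpha> \<beta> \<longleftrightarrow>
     a * b * \<alpha> * \<beta> \<noteq> 0 \<and> \<not> (\<exists>k::nat. k > 0 \<and> (\<alpha> / \<beta>) ^ k = 1)"

text \<open>
  The general recursive (total computable) functions of arity \<open>k\<close>, in Kleene's presentation:
  basic functions, closed under composition, primitive recursion and minimisation of regular
  functions (those for which a zero always exists, so that the result is total). A function of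
  arity \<open>k\<close> is represented by a function on lists of which only the values at lists
  of length \<open>k\<close> matter; rule \<open>ext\<close> makes the notion independent of the other values.
\<close>

inductive general_recursive :: "nat \<Rightarrow> (nat list \<Rightarrow> nat) \<Rightarrow> bool" where
  zero: "general_recursive k (\<lambda>xs. 0)"
| succ: "general_recursive 1 (\<lambda>xs. Suc (hd xs))"
| proj: "i < k \<Longrightarrow> general_recursive k (\<lambda>xs. xs ! i)"
| comp: "general_recursive (length gs) f \<Longrightarrow> (\<forall>g\<in>set gs. general_recursive k g) \<Longrightarrow>
    general_recursive k (\<lambda>xs. f (map (\<lambda>g. g xs) gs))"
| prim_rec: "general_recursive k f \<Longrightarrow> general_recursive (Suc (Suc k)) g \<Longrightarrow>
    general_recursive (Suc k)
      (\<lambda>xs. rec_nat (f (tl xs)) (\<lambda>n v. g (n # v # tl xs)) (hd xs))"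
| minim: "general_recursive (Suc k) f \<Longrightarrow>
    (\<forall>xs. length xs = k \<longrightarrow> (\<exists>n. f (n # xs) = 0)) \<Longrightarrow>
    general_recursive k (\<lambda>xs. LEAST n. f (n # xs) = 0)"
| ext: "general_recursive k f \<Longrightarrow> (\<forall>xs. length xs = k \<longrightarrow> g xs = f xs) \<Longrightarrow>
    general_recursive k g"

text \<open>
  A threshold depending on a binary recurrence (given by its coefficients \<open>r\<close>, \<open>s\<close> and its
  initial values \<open>u0\<close>, \<open>u1\<close>, equivalently by \<open>a\<close>, \<open>b\<close>, \<open>\<alpha>\<close>, \<open>\<beta>\<close>) and on a positive
  rational number \<open>p / q\<close> is effectively computable if it is a general recursive function of
  these data. Integers are coded as natural numbers by the library bijection
  \<open>int_encode\<close>.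
\<close>

definition effectively_computable ::
    "(int \<Rightarrow> int \<Rightarrow> int \<Rightarrow> int \<Rightarrow> nat \<Rightarrow> nat \<Rightarrow> nat) \<Rightarrow> bool" where
  "effectively_computable C \<longleftrightarrow>
     (\<exists>f. general_recursive 6 f \<and>
        (\<forall>r s u0 u1 p q.
           C r s u0 u1 p q =
             f [int_encode r, int_encode s, int_encode u0, int_encode u1, p, q]))"

end

theory Submission
  imports Defs
begin

text \<open>
  Put \<open>g = gcd (r\<^sup>2) s\<close> and \<open>w n = (u n)\<^sup>2 / g ^ (n - 1)\<close>, an integer of logarithmic size about
  \<open>l * n\<close>, and let \<open>T d\<close> be the same quantity for the Lucas sequence of \<open>r\<close> and \<open>s\<close>.
  If \<open>q = p ^ k\<close> divides \<open>w n\<close> and \<open>w (n + d)\<close>, then \<open>q\<close> divides \<open>D\<^sup>2 * T d\<close> up to primes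
  dividing \<open>s / g\<close>, which contribute a bounded amount to each term. Hence in an interval of
  length \<open>M\<close> the term of largest \<open>p\<close>-adic valuation carries everything but a part that divides
  the product of the \<open>D\<^sup>2 * T d\<close> with \<open>d < M\<close>. Removing one such term for each of
  the \<open>t\<close> primes from \<open>{N - M<..N}\<close> leaves a product of logarithmic size at least about
  \<open>l * ((N - t)\<^sup>2 - (N - M)\<^sup>2) / 2\<close>, while the divisor bound gives at most \<open>l * M\<^sup>2 / 2\<close>. The
  optimal choice \<open>M = N / 2\<close> yields \<open>(N - t)\<^sup>2 \<le> N\<^sup>2 / 2\<close> up to lower order.

  Terms that are abnormally small at the archimedean place are removed as well: by the same
  determinant identity they are far apart, so no lower bound for linear forms in logarithms
  is needed, and all constants are polynomial in the data.
\<close>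

subsection \<open>Recursive functions\<close>

lemma general_recursive_const: "general_recursive k (\<lambda>xs. c)"
proof (induction c)
  case 0
  show ?case by (rule general_recursive.zero)
next
  case (Suc c)
  have "general_recursive k (\<lambda>xs. (\<lambda>ys. Suc (hd ys)) (map (\<lambda>g. g xs) [\<lambda>xs. c]))"
    by (rule general_recursive.comp) (use Suc general_recursive.succ in auto)
  then show ?case by simp
qed

lemma general_recursive_binary:
  assumes h: "general_recursive 2 (\<lambda>xs. h (xs ! 0) (xs ! 1))"
    and f: "general_recursive k f" and g: "general_recursive k g"
  shows "general_recursive k (\<lambda>xs. h (f xs) (g xs))"
proof -
  have "general_recursive k
      (\<lambda>xs. (\<lambda>ys. h (ys ! 0) (ys ! 1)) (map (\<lambda>g. g xs) [f, g]))"
    by (rule general_recursive.comp) (use assms in \<open>auto simp: numeral_2_eq_2\<close>)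
  then show ?thesis by simp
qed

lemma general_recursive_add:
  assumes "general_recursive k f" "general_recursive k g"
  shows "general_recursive k (\<lambda>xs. f xs + g xs)"
proof (rule general_recursive_binary[OF _ assms])
  have suc: "general_recursive 3 (\<lambda>xs. Suc (xs ! 1))"
    using general_recursive.comp[of "[\<lambda>xs. xs ! 1]" "\<lambda>ys. Suc (hd ys)" 3]
      general_recursive.succ general_recursive.proj[of 1 3] by simp
  have "general_recursive (Suc 1)
      (\<lambda>xs. rec_nat (tl xs ! 0) (\<lambda>n v. Suc ((n # v # tl xs) ! 1)) (hd xs))"
    by (rule general_recursive.prim_rec)
      (use suc general_recursive.proj[of 0 1] in \<open>simp_all add: numeral_3_eq_3\<close>)
  moreover have "rec_nat y (\<lambda>n v. Suc v) x = x + y" for x y :: nat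
    by (induction x) auto
  ultimately have "general_recursive (Suc 1) (\<lambda>xs. hd xs + tl xs ! 0)"
    by simp
  \<comment> \<open>\<open>hd xs\<close> and \<open>tl xs ! 0\<close> match \<open>xs ! 0\<close>
    and \<open>xs ! 1\<close> on lists of length 2, which is all that \<open>ext\<close> asks
    for.\<close>
  then show "general_recursive 2 (\<lambda>xs. xs ! 0 + xs ! 1)"
    unfolding numeral_2_eq_2 One_nat_def
    by (rule general_recursive.ext) (auto simp: length_Suc_conv)
qed

lemma general_recursive_mult:
  assumes "general_recursive k f" "general_recursive k g"
  shows "general_recursive k (\<lambda>xs. f xs * g xs)"
proof (rule general_recursive_binary[OF _ assms])
  have step: "general_recursive (Suc (Suc 1)) (\<lambda>xs. xs ! 1 + xs ! 2)"
    by (intro general_recursive_add general_recursive.proj) auto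
  have "general_recursive (Suc 1)
      (\<lambda>xs. rec_nat 0 (\<lambda>n v. (n # v # tl xs) ! 1 + (n # v # tl xs) ! 2) (hd xs))"
    by (rule general_recursive.prim_rec[OF general_recursive.zero step])
  moreover have "rec_nat 0 (\<lambda>n v. v + y) x = x * y" for x y :: nat
    by (induction x) auto
  ultimately have "general_recursive (Suc 1) (\<lambda>xs. hd xs * tl xs ! 0)"
    by simp
  then show "general_recursive 2 (\<lambda>xs. xs ! 0 * xs ! 1)"
    unfolding numeral_2_eq_2 One_nat_def
    by (rule general_recursive.ext) (auto simp: length_Suc_conv)
qed

lemma general_recursive_power:
  assumes "general_recursive k f"
  shows "general_recursive k (\<lambda>xs. f xs ^ n)"
  using assms
  by (induction n) (auto intro: general_recursive_const general_recursive_mult)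

text \<open>The code of i is 2 i for i \<ge> 0 and -2 i - 1 for i < 0. So the codes themselves bound
  the data, and the threshold can be a polynomial in the codes.\<close>

lemma abs_le_int_encode: "\<bar>i\<bar> \<le> int (int_encode i)"
  by (auto simp: int_encode_def sum_encode_def)

subsection \<open>Divisibility\<close>

text \<open>For distinct roots this is (\<alpha>^n - \<beta>^n) / (\<alpha> - \<beta>), see
  \<open>lucas_binet\<close>.\<close>

fun lucas :: "int \<Rightarrow> int \<Rightarrow> nat \<Rightarrow> int" where
  "lucas r s 0 = 0"
| "lucas r s (Suc 0) = 1"
| "lucas r s (Suc (Suc n)) = r * lucas r s (Suc n) + s * lucas r s n"

text \<open>
  Divisibility of squares replaces divisibility in the ring containing the square root of \<open>g\<close>,
  in which the normalised terms \<open>u n / sqrt g ^ (n - 1)\<close> live.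
\<close>

lemma dvd_square_add:
  fixes x y c :: int
  assumes "c dvd x\<^sup>2" "c dvd y\<^sup>2"
  shows "c dvd (x + y)\<^sup>2"
proof -
  have "c\<^sup>2 dvd (x * y)\<^sup>2"
    using mult_dvd_mono[OF assms] by (simp add: power2_eq_square mult_ac)
  then have "c dvd x * y" by simp
  moreover have "(x + y)\<^sup>2 = x\<^sup>2 + y\<^sup>2 + 2 * (x * y)" by (simp add: power2_sum)
  ultimately show ?thesis using assms by (simp add: dvd_add)
qed

lemma dvd_square_diff:
  fixes x y c :: int
  assumes "c dvd x\<^sup>2" "c dvd y\<^sup>2"
  shows "c dvd (x - y)\<^sup>2"
  using dvd_square_add[of c x "- y"] assms by simp

section \<open>Determinant identities and the common power of \<open>g\<close>\<close>

locale binary_recurrence =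
  fixes r s :: int and u :: "nat \<Rightarrow> int"
  assumes u_rec: "u (Suc (Suc n)) = r * u (Suc n) + s * u n"
begin

text \<open>The form (x - \<alpha> y)(x - \<beta> y) at x = \<open>u 1\<close>, y =
  \<open>u 0\<close>; in terms of the coefficients it is -(\<alpha> - \<beta>)^2 a b.\<close>

definition D :: int where "D = (u 1)\<^sup>2 - r * u 1 * u 0 - s * (u 0)\<^sup>2"

text \<open>For s \<noteq> 0, dividing both roots by sqrt g turns r^2 and s into the coprime
  integers r^2 / g and s / g.\<close>

definition g :: int where "g = gcd (r\<^sup>2) s"

definition w :: "nat \<Rightarrow> int" where "w n = (u n)\<^sup>2 div g ^ (n - 1)"

text \<open>One step of the recurrence multiplies the form by -s, the determinant of the companion
  matrix.\<close>

lemma norm_form: "(u (Suc n))\<^sup>2 - r * u (Suc n) * u n - s * (u n)\<^sup>2 = (- s) ^ n * D"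
proof (induction n)
  case 0
  then show ?case by (simp add: D_def)
next
  case (Suc n)
  have "(u (Suc (Suc n)))\<^sup>2 - r * u (Suc (Suc n)) * u (Suc n) - s * (u (Suc n))\<^sup>2
    = (- s) * ((u (Suc n))\<^sup>2 - r * u (Suc n) * u n - s * (u n)\<^sup>2)"
    by (simp add: u_rec power2_eq_square algebra_simps)
  with Suc show ?case by (simp add: algebra_simps)
qed

text \<open>Both sides satisfy the recurrence in d; they vanish at d = 0, and d = 1 is
  \<open>norm_form\<close>. The identity forces common divisors of two terms at distance d into the
  right-hand side.\<close>

lemma cross_identity:
  "u (n + d) * u (Suc n) - u n * u (Suc (n + d)) = (- s) ^ n * D * lucas r s d"
proof (induction d rule: induct_nat_012)
  case 0
  then show ?case by simp
next
  case 1
  then show ?case using norm_form[of n]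
    by (simp add: u_rec power2_eq_square algebra_simps)
next
  case (ge2 d)
  have "u (n + Suc (Suc d)) * u (Suc n) - u n * u (Suc (n + Suc (Suc d)))
    = r * (u (n + Suc d) * u (Suc n) - u n * u (Suc (n + Suc d)))
      + s * (u (n + d) * u (Suc n) - u n * u (Suc (n + d)))"
    by (simp add: u_rec algebra_simps)
  also have "\<dots> = (- s) ^ n * D * lucas r s (Suc (Suc d))"
    unfolding ge2 by (simp add: algebra_simps)
  finally show ?case .
qed

lemma g_dvd: "g dvd r\<^sup>2" "g dvd s" "g dvd s\<^sup>2"
  by (auto simp: g_def power2_eq_square)

text \<open>Squaring r gains one factor g over the preceding term, squaring s gains two over the
  term before that. Hence the division in \<open>w\<close> is exact.\<close>

lemma g_power_dvd: "g ^ n dvd (u (Suc n))\<^sup>2"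
proof (induction n rule: induct_nat_012)
  case 0
  then show ?case by simp
next
  case 1
  have "g dvd (r * u 1 + s * u 0)\<^sup>2"
    by (rule dvd_square_add) (use g_dvd in \<open>simp_all add: power_mult_distrib\<close>)
  then show ?case by (simp add: u_rec)
next
  case (ge2 n)
  have "g ^ (Suc (Suc n)) dvd (r * u (Suc (Suc n)))\<^sup>2"
    using mult_dvd_mono[OF g_dvd(1) ge2(2)] by (simp add: power_mult_distrib)
  moreover have "g ^ (Suc (Suc n)) dvd (s * u (Suc n))\<^sup>2"
    using mult_dvd_mono[OF g_dvd(2) mult_dvd_mono[OF g_dvd(2) ge2(1)]]
    by (simp add: power_mult_distrib power2_eq_square mult_ac)
  ultimately show ?case using dvd_square_add by (simp add: u_rec)
qed

lemma g_power_mult_w: "n \<ge> 1 \<Longrightarrow> g ^ (n - 1) * w n = (u n)\<^sup>2"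
  using g_power_dvd[of "n - 1"] by (simp add: w_def)

end

lemma binary_recurrence_lucas: "binary_recurrence r s (lucas r s)"
  by unfold_locales simp

section \<open>Common divisors of two normalised terms\<close>

text \<open>\<open>D_nz\<close> and \<open>lucas_nz\<close> carry non-degeneracy over to the
  integers: they keep every \<open>D\<^sup>2 * T d\<close> with d \<ge> 1 nonzero.\<close>

locale proper_recurrence = binary_recurrence +
  assumes s_nz: "s \<noteq> 0" and D_nz: "D \<noteq> 0"
    and lucas_nz: "\<And>d. d \<ge> 1 \<Longrightarrow> lucas r s d \<noteq> 0"
begin

definition s' :: int where "s' = s div g"

definition t :: "nat \<Rightarrow> int" where "t = lucas r s"

definition T :: "nat \<Rightarrow> int" where "T n = (t n)\<^sup>2 div g ^ (n - 1)"

lemma g_pos: "g \<ge> 1"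
proof -
  have "g > 0" using s_nz by (simp add: g_def)
  then show ?thesis by simp
qed

lemma s_eq: "s = g * s'"
  using g_dvd(2) by (simp add: s'_def)

lemma s_power: "s ^ n = g ^ n * s' ^ n"
  using arg_cong[OF s_eq, of "\<lambda>x. x ^ n"] by (simp only: power_mult_distrib)

lemma s'_nz: "s' \<noteq> 0"
  using s_nz s_eq by fastforce

lemma coprime_s': "coprime (r\<^sup>2 div g) s'"
  unfolding s'_def g_def using s_nz by (intro div_gcd_coprime) auto

lemma g_power_mult_T: "n \<ge> 1 \<Longrightarrow> g ^ (n - 1) * T n = (t n)\<^sup>2"
proof -
  interpret L: binary_recurrence r s "lucas r s" by (rule binary_recurrence_lucas)
  show "n \<ge> 1 \<Longrightarrow> ?thesis"
    using L.g_power_mult_w[of n] by (simp add: T_def L.w_def t_def)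
qed

lemma T_nz: "n \<ge> 1 \<Longrightarrow> T n \<noteq> 0"
  using g_power_mult_T[of n] lucas_nz[of n] by (auto simp: t_def)

text \<open>In \<open>cross_identity\<close>, the square of each product on the left is divisible by
  q g^(2n+d-1): one factor supplies q, and \<open>g_power_dvd\<close> handles its neighbour. The
  square of the right-hand side contains exactly this explicit power of g, which cancels.\<close>

lemma dvd_cross:
  assumes n: "n \<ge> 1" and d: "d \<ge> 1" and "q dvd w n" "q dvd w (n + d)"
  shows "q dvd s' ^ (2 * n) * (D\<^sup>2 * T d)"
proof -
  have nd: "n + d \<ge> 1" using n by simp
  have G: "g ^ (n + (n + d) - 1) = g ^ (n - 1) * g ^ (n + d)"
          "g ^ (n + (n + d) - 1) = g ^ n * g ^ (n + d - 1)"
    using n by (simp_all flip: power_add)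
  have a: "q * g ^ (n - 1) dvd (u n)\<^sup>2"
    unfolding g_power_mult_w[OF n, symmetric] mult.commute[of "g ^ (n - 1)"]
    by (intro mult_dvd_mono assms dvd_refl)
  have b: "q * g ^ (n + d - 1) dvd (u (n + d))\<^sup>2"
    unfolding g_power_mult_w[OF nd, symmetric] mult.commute[of "g ^ (n + d - 1)"]
    by (intro mult_dvd_mono assms dvd_refl)
  have "q * g ^ (n + (n + d) - 1) dvd (u (n + d) * u (Suc n))\<^sup>2"
    using mult_dvd_mono[OF b g_power_dvd[of n]] unfolding G(2)
    by (simp add: power_mult_distrib mult_ac)
  moreover have "q * g ^ (n + (n + d) - 1) dvd (u n * u (Suc (n + d)))\<^sup>2"
    using mult_dvd_mono[OF a g_power_dvd[of "n + d"]] unfolding G(1)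
    by (simp add: power_mult_distrib mult_ac)
  ultimately have "q * g ^ (n + (n + d) - 1) dvd ((- s) ^ n * D * t d)\<^sup>2"
    unfolding t_def cross_identity[symmetric] by (rule dvd_square_diff)
  also have "((- s) ^ n * D * t d)\<^sup>2 = s ^ (2 * n) * (D\<^sup>2 * (t d)\<^sup>2)"
    by (simp add: power_mult_distrib mult.commute[of 2] power_mult power2_eq_square)
       (simp flip: power_mult_distrib)
  also have "\<dots> = (s' ^ (2 * n) * (D\<^sup>2 * T d)) * (g ^ (2 * n) * g ^ (d - 1))"
    unfolding g_power_mult_T[OF d, symmetric] s_power by (simp add: mult_ac)
  also have "g ^ (2 * n) * g ^ (d - 1) = g ^ (n + (n + d) - 1)"
    using n d by (simp flip: power_add add: mult_2 add.assoc)
  finally show ?thesis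
    using g_pos by simp
qed

lemma dvd_cross_prime:
  assumes "prime p" "\<not> p dvd s'" "n \<ge> 1" "d \<ge> 1" "p ^ k dvd w n" "p ^ k dvd w (n + d)"
  shows "p ^ k dvd D\<^sup>2 * T d"
proof -
  have "coprime (p ^ k) (s' ^ (2 * n))"
    using assms by (simp add: prime_imp_coprime)
  then show ?thesis
    using dvd_cross[OF assms(3-6)] by (simp add: coprime_dvd_mult_right_iff)
qed

section \<open>Primes dividing \<open>s / g\<close>\<close>

text \<open>After squaring the recurrence, the terms containing s are divisible by g^n s'. For the
  cross term this needs g^(n-1) to divide r t(n) t(n-1), which is read off from the square of that
  number.\<close>

lemma T_cong: "n \<ge> 1 \<Longrightarrow> s' dvd T (Suc n) - (r\<^sup>2 div g) * T n"
proof -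
  assume n: "n \<ge> 1"
  show ?thesis
  proof (cases "n = 1")
    case True
    then show ?thesis by (simp add: T_def t_def numeral_2_eq_2)
  next
    case False
    with n obtain m where m: "n = Suc (Suc m)"
      by (metis One_nat_def Suc_le_D le_SucE not0_implies_Suc not_less_eq_eq)
    define x where "x = r * t (Suc (Suc m)) * t (Suc m)"
    have L: "binary_recurrence r s t"
      unfolding t_def by (rule binary_recurrence_lucas)
    interpret L: binary_recurrence r s t by (rule L)
    have "g * (g ^ Suc m * g ^ m) dvd r\<^sup>2 * ((t (Suc (Suc m)))\<^sup>2 * (t (Suc m))\<^sup>2)"
      by (intro mult_dvd_mono g_dvd L.g_power_dvd)
    moreover have "g * (g ^ Suc m * g ^ m) = (g ^ Suc m)\<^sup>2"
      by (simp add: power2_eq_square)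
    moreover have "r\<^sup>2 * ((t (Suc (Suc m)))\<^sup>2 * (t (Suc m))\<^sup>2) = x\<^sup>2"
      by (simp only: x_def power_mult_distrib mult.assoc)
    ultimately have "(g ^ Suc m)\<^sup>2 dvd x\<^sup>2" by argo
    then have "g ^ Suc m dvd x" by simp
    then obtain y where y: "x = g ^ Suc m * y" by (rule dvdE)
    have rg: "r\<^sup>2 = g * (r\<^sup>2 div g)" using g_dvd(1) by simp
    have "g ^ Suc (Suc m) * T (Suc n) = (t (Suc n))\<^sup>2"
      using g_power_mult_T[of "Suc n"] m by simp
    also have "\<dots> = r\<^sup>2 * (t n)\<^sup>2 + 2 * s * x + s\<^sup>2 * (t (Suc m))\<^sup>2"
      unfolding m L.u_rec x_def by (simp add: power2_eq_square algebra_simps)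
    also have "\<dots> = g * (r\<^sup>2 div g) * (g ^ Suc m * T n) + 2 * (g * s') * (g ^ Suc m * y)
        + (g * s')\<^sup>2 * (g ^ m * T (Suc m))"
      using g_power_mult_T[of n] g_power_mult_T[of "Suc m"] m s_power[of 2] arg_cong[OF s_eq, of "\<lambda>z. 2 * z * x"] rg y
      by (simp only: power_mult_distrib diff_Suc_1 le_add1 plus_1_eq_Suc mult.assoc)
    also have "\<dots> = g ^ Suc (Suc m) * ((r\<^sup>2 div g) * T n + s' * (2 * y + s' * T (Suc m)))"
      by (simp add: power2_eq_square algebra_simps)
    finally have "T (Suc n) = (r\<^sup>2 div g) * T n + s' * (2 * y + s' * T (Suc m))"
      using g_pos by simp
    then show ?thesis by simp
  qed
qed

text \<open>Modulo s', \<open>T n\<close> is a power of r^2 / g, which is coprime to s'.\<close>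

lemma coprime_T: "n \<ge> 1 \<Longrightarrow> coprime (T n) s'"
proof (induction n rule: nat_induct_at_least)
  case base
  then show ?case by (simp add: T_def t_def)
next
  case (Suc n)
  have "coprime ((r\<^sup>2 div g) * T n) s'"
    using Suc coprime_s' by simp
  moreover obtain k where "T (Suc n) = (r\<^sup>2 div g) * T n + s' * k"
    using T_cong[OF Suc(1)] by (metis add.commute diff_add_cancel dvdE)
  ultimately show ?case
    by (simp add: coprime_iff_gcd_eq_1 gcd.commute[of _ s'] gcd_add_mult mult.commute add.commute)
qed

text \<open>For p dividing s', the factor s'^(2n) in \<open>dvd_cross\<close> is harmful. Instead,
  \<open>norm_form\<close> passes divisibility from \<open>u n\<close> on to
  \<open>u (Suc n)\<close>, and \<open>cross_identity\<close> is then taken from index 0, where no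
  power of s occurs.\<close>

lemma dvd_D_square:
  assumes p: "prime p" "p dvd s'" and n: "n \<ge> 1" and j: "j \<le> n" and w: "p ^ (2 * j) dvd w n"
  shows "p ^ j dvd D\<^sup>2"
proof -
  obtain m where m: "n = Suc m" using n by (cases n) auto
  have un: "p ^ (2 * j) * g ^ m dvd (u n)\<^sup>2"
    unfolding g_power_mult_w[OF n, symmetric] mult.commute[of "g ^ (n - 1)"]
    using mult_dvd_mono[OF w dvd_refl] by (simp only: m diff_Suc_1)
  have p2: "p ^ (2 * j) = p ^ j * p ^ j" by (simp add: mult_2 power_add)
  have pj: "p ^ j dvd p ^ (2 * j)" by (simp add: le_imp_power_dvd)
  have "p ^ j * g ^ n dvd s * (u n)\<^sup>2"
  proof -
    have "g * (p ^ j * g ^ m) dvd s * (u n)\<^sup>2"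
      using mult_dvd_mono[OF g_dvd(2) dvd_trans[OF mult_dvd_mono[OF pj dvd_refl] un]] .
    then show ?thesis by (simp add: m mult_ac)
  qed
  \<comment> \<open>Only the square of this product is controlled; the exponent 2 j in the
    hypothesis leaves p^j after the square root.\<close>
  moreover have "p ^ j * g ^ n dvd r * u (Suc n) * u n"
  proof -
    have "g * (g ^ n * (p ^ j * p ^ j * g ^ m)) dvd r\<^sup>2 * ((u (Suc n))\<^sup>2 * (u n)\<^sup>2)"
      by (intro mult_dvd_mono g_dvd g_power_dvd un[unfolded p2])
    moreover have "g * (g ^ n * (p ^ j * p ^ j * g ^ m)) = (p ^ j * g ^ n)\<^sup>2"
      by (simp add: m power2_eq_square)
    moreover have "r\<^sup>2 * ((u (Suc n))\<^sup>2 * (u n)\<^sup>2) = (r * u (Suc n) * u n)\<^sup>2"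
      by (simp only: power_mult_distrib mult.assoc)
    ultimately have "(p ^ j * g ^ n)\<^sup>2 dvd (r * u (Suc n) * u n)\<^sup>2" by argo
    then show ?thesis by simp
  qed
  moreover have "p ^ j * g ^ n dvd (- s) ^ n * D"
  proof -
    \<comment> \<open>This is where j \<le> n enters: s'^n supplies n factors p.\<close>
    have "p ^ j dvd s' ^ n"
      using p(2) j by (rule dvd_power_le)
    then have "p ^ j * g ^ n dvd s ^ n"
      unfolding s_power by (simp add: mult.commute mult_dvd_mono)
    moreover have "s ^ n dvd (- s) ^ n" by (simp add: power_minus')
    ultimately show ?thesis using dvd_mult2 dvd_trans by blast
  qed
  moreover have "(u (Suc n))\<^sup>2 = (- s) ^ n * D + r * u (Suc n) * u n + s * (u n)\<^sup>2"
    using norm_form[of n] by simp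
  ultimately have un1: "p ^ j * g ^ n dvd (u (Suc n))\<^sup>2"
    by (simp add: dvd_add)
  have "p ^ j * g ^ m dvd (u n * u 1)\<^sup>2"
    using dvd_trans[OF mult_dvd_mono[OF pj dvd_refl] un] by (simp add: power_mult_distrib)
  moreover have "p ^ j * g ^ m dvd (u 0 * u (Suc n))\<^sup>2"
    using dvd_trans[OF _ un1, of "p ^ j * g ^ m"]
    by (simp add: power_mult_distrib m mult_dvd_mono)
  ultimately have "p ^ j * g ^ m dvd (D * t n)\<^sup>2"
    using cross_identity[of 0 n] dvd_square_diff[of "p ^ j * g ^ m" "u n * u 1" "u 0 * u (Suc n)"]
    by (simp add: t_def)
  also have "(D * t n)\<^sup>2 = D\<^sup>2 * T n * g ^ m"
    using g_power_mult_T[OF n] m by (simp add: power_mult_distrib mult_ac)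
  finally have "p ^ j dvd D\<^sup>2 * T n"
    using g_pos by simp
  moreover have "coprime (p ^ j) (T n)"
    using coprime_divisors[OF dvd_refl p(2) coprime_T[OF n]] by (simp add: coprime_commute)
  ultimately show ?thesis
    by (simp add: coprime_dvd_mult_left_iff)
qed

text \<open>With v the valuation of D, \<open>dvd_D_square\<close> at j = 2 v + 1 would contradict
  that \<open>D\<^sup>2\<close> has valuation 2 v, so the valuation of \<open>w n\<close> is below 2
  j = 4 v + 2. The bound on n ensures j \<le> n, since v < 2^v \<le> |D|.\<close>

lemma multiplicity_w_le:
  assumes p: "prime p" "p dvd s'" and n: "n \<ge> 2 * nat \<bar>D\<bar> + 1" and "w n \<noteq> 0"
  shows "multiplicity p (w n) \<le> 4 * multiplicity p D + 1"
proof (rule ccontr)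
  assume a: "\<not> ?thesis"
  define v where "v = multiplicity p D"
  have pv: "p ^ v dvd D" by (simp add: v_def multiplicity_dvd)
  have "int v < 2 ^ v" by (metis of_nat_less_two_power)
  also have "2 ^ v \<le> p ^ v" using prime_ge_2_int[OF p(1)] by (intro power_mono) auto
  also have "\<dots> \<le> \<bar>D\<bar>" using pv D_nz by (simp add: dvd_imp_le_int zdvd_imp_le)
  finally have v: "2 * v + 1 \<le> n" using n by linarith
  have "p ^ (2 * (2 * v + 1)) dvd w n"
    using a by (intro multiplicity_dvd') (simp add: v_def)
  from dvd_D_square[OF p _ v this] have "p ^ (2 * v + 1) dvd D\<^sup>2"
    using n by simp
  then have "2 * v + 1 \<le> multiplicity p (D\<^sup>2)"
    using D_nz p(1) by (intro multiplicity_geI) auto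
  also have "\<dots> = 2 * v"
    unfolding v_def using p(1) D_nz by (intro prime_elem_multiplicity_power_distrib) auto
  finally show False by simp
qed

end

subsection \<open>Counting\<close>

lemma sum_eq_sum_card_levels:
  fixes f :: "'a \<Rightarrow> nat"
  assumes "finite S" and m: "\<And>n. n \<in> S \<Longrightarrow> f n \<le> m"
  shows "sum f S = (\<Sum>k=1..m. card {n \<in> S. k \<le> f n})"
proof -
  have "sum f S = (\<Sum>n\<in>S. card {k \<in> {1..m}. k \<le> f n})"
  proof (rule sum.cong)
    fix n assume "n \<in> S"
    then have "{k \<in> {1..m}. k \<le> f n} = {1..f n}" using m[of n] by auto
    then show "f n = card {k \<in> {1..m}. k \<le> f n}" by simp
  qed simp
  also have "\<dots> = (\<Sum>k=1..m. card {n \<in> S. k \<le> f n})"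
    using assms(1) by (intro sum_multicount_gen) auto
  finally show ?thesis .
qed

text \<open>A maximal element lies in every nonempty level set, so removing it lowers each of these
  cardinalities by one and cancels the \<open>Suc\<close>. Summing over the levels recovers the
  sums.\<close>

lemma sum_remove_max_le:
  fixes f :: "'a \<Rightarrow> nat" and h :: "'b \<Rightarrow> nat"
  assumes S: "finite S" and E: "finite E"
    and n0: "n0 \<in> S" "\<And>n. n \<in> S \<Longrightarrow> f n \<le> f n0"
    and le: "\<And>k. k \<ge> 1 \<Longrightarrow> card {n \<in> S. k \<le> f n} \<le> Suc (card {d \<in> E. k \<le> h d})"
  shows "sum f (S - {n0}) \<le> sum h E"
proof -
  define m where "m = Max (insert (f n0) (h ` E))"
  have hm: "\<And>d. d \<in> E \<Longrightarrow> h d \<le> m" and fm: "f n0 \<le> m"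
    using E by (auto simp: m_def)
  have "sum f (S - {n0}) = (\<Sum>k=1..f n0. card {n \<in> S - {n0}. k \<le> f n})"
    using S n0 by (intro sum_eq_sum_card_levels) auto
  also have "\<dots> \<le> (\<Sum>k=1..f n0. card {d \<in> E. k \<le> h d})"
  proof (rule sum_mono)
    fix k assume k: "k \<in> {1..f n0}"
    have "{n \<in> S - {n0}. k \<le> f n} = {n \<in> S. k \<le> f n} - {n0}" by auto
    moreover have "n0 \<in> {n \<in> S. k \<le> f n}" using k n0 by simp
    ultimately have "Suc (card {n \<in> S - {n0}. k \<le> f n}) = card {n \<in> S. k \<le> f n}"
      using S card.remove[of "{n \<in> S. k \<le> f n}" n0] by simp
    then show "card {n \<in> S - {n0}. k \<le> f n} \<le> card {d \<in> E. k \<le> h d}"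
      using le[of k] k by simp
  qed
  also have "\<dots> \<le> (\<Sum>k=1..m. card {d \<in> E. k \<le> h d})"
    using fm by (intro sum_mono2) auto
  also have "\<dots> = sum h E"
    using hm E by (intro sum_eq_sum_card_levels[symmetric]) auto
  finally show ?thesis .
qed

text \<open>The quotients (n - c) div K are distinct and at most M div K.\<close>

lemma card_le_of_separated:
  fixes Z :: "nat set"
  assumes Z: "Z \<subseteq> {c<..c + M}" and K: "K \<ge> 1"
    and sep: "\<And>n m. n \<in> Z \<Longrightarrow> m \<in> Z \<Longrightarrow> n < m \<Longrightarrow> K \<le> m - n"
  shows "card Z \<le> Suc (M div K)"
proof -
  have "inj_on (\<lambda>n. (n - c) div K) Z"
  proof (rule linorder_inj_onI')
    fix n m assume nm: "n \<in> Z" "m \<in> Z" "n < m"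
    have "n \<ge> c" using nm Z by auto
    then have "n - c + K \<le> m - c" using sep[OF nm] nm by linarith
    then have "(n - c + K) div K \<le> (m - c) div K" by (rule div_le_mono)
    then show "(n - c) div K \<noteq> (m - c) div K" using K by simp
  qed
  moreover have "(\<lambda>n. (n - c) div K) ` Z \<subseteq> {..M div K}"
    using Z by (force intro!: div_le_mono)
  ultimately have "card Z \<le> card {..M div K}" by (intro card_inj_on_le) auto
  then show ?thesis by simp
qed

text \<open>Reflecting n to N - n reduces this to the fact that k distinct naturals have sum at
  least 0 + ... + (k - 1).\<close>

lemma sum_le_top:
  fixes Y :: "nat set"
  assumes Y: "Y \<subseteq> {..N}"
  shows "2 * (\<Sum>n\<in>Y. real n) \<le> real (card Y) * (2 * real N + 1 - real (card Y))"
proof -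
  have fin: "finite Y" using Y finite_subset by blast
  have inj: "inj_on (\<lambda>n. N - n) Y"
    by (rule inj_onI) (use Y in \<open>metis atMost_iff diff_diff_cancel subsetD\<close>)
  have "2 * real (\<Sum>{0..<k}) = real k * (real k - 1)" for k
    by (induction k) (auto simp: algebra_simps)
  then have gauss: "real (\<Sum>{0..<card Y}) = real (card Y) * (real (card Y) - 1) / 2"
    by (metis nonzero_mult_div_cancel_left zero_neq_numeral)
  have "\<Sum>{0..<card Y} \<le> \<Sum>((\<lambda>n. N - n) ` Y)"
    using card_sum_le_nat_sum[of "(\<lambda>n. N - n) ` Y"] by (simp add: card_image[OF inj])
  also have "\<dots> = (\<Sum>n\<in>Y. N - n)" by (simp add: sum.reindex[OF inj])
  finally have "real (\<Sum>{0..<card Y}) \<le> real (\<Sum>n\<in>Y. N - n)" by linarith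
  also have "real (\<Sum>n\<in>Y. N - n) = (\<Sum>n\<in>Y. real N - real n)"
    using Y by (auto intro!: sum.cong simp: of_nat_diff)
  also have "\<dots> = real (card Y) * real N - (\<Sum>n\<in>Y. real n)" by (simp add: sum_subtractf)
  finally show ?thesis unfolding gauss by (simp add: field_simps)
qed

text \<open>The worst case removes the k largest numbers and leaves (N - k)(N - k + 1) - c (c + 1)
  for twice the sum; since k \<le> N - c, the linear terms may be dropped.\<close>

lemma sum_Diff_ge:
  fixes Y :: "nat set"
  assumes Y: "Y \<subseteq> {c<..N}" and c: "c \<le> N"
  shows "2 * (\<Sum>n\<in>{c<..N} - Y. real n) \<ge> (real N - real (card Y))\<^sup>2 - (real c)\<^sup>2"
proof -
  have "2 * (\<Sum>n\<in>{c<..N}. real n) = real N * (real N + 1) - real c * (real c + 1)"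
    using c by (induction N rule: dec_induct)
      (simp_all add: atLeastSucAtMost_greaterThanAtMost[symmetric] sum.atLeast_Suc_atMost algebra_simps)
  moreover have "2 * (\<Sum>n\<in>Y. real n) \<le> real (card Y) * (2 * real N + 1 - real (card Y))"
    using Y by (intro sum_le_top) auto
  moreover have "(\<Sum>n\<in>{c<..N} - Y. real n) = (\<Sum>n\<in>{c<..N}. real n) - (\<Sum>n\<in>Y. real n)"
    using Y by (simp add: sum_diff)
  moreover have "card Y \<le> N - c"
    using card_mono[OF _ Y] by simp
  then have "real (card Y) \<le> real N - real c" using c by linarith
  ultimately show ?thesis by (simp add: power2_eq_square algebra_simps)
qed

section \<open>Removing one term for each prime\<close>

context proper_recurrence
begin

lemma w_dvd: "n \<ge> 1 \<Longrightarrow> w n dvd (u n)\<^sup>2"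
  using g_power_mult_w[of n] by (metis dvd_triv_right)

lemma w_nz: "n \<ge> 1 \<Longrightarrow> u n \<noteq> 0 \<Longrightarrow> w n \<noteq> 0"
  using g_power_mult_w[of n] by auto

text \<open>Subtracting the least index of the level set maps the other indices injectively to
  differences d, where \<open>dvd_cross_prime\<close> applies. The \<open>Suc\<close> counts the
  least index itself.\<close>

lemma card_levels_le:
  assumes p: "prime p" "\<not> p dvd s'" and S: "S \<subseteq> {c<..c + M}" and u: "\<And>n. n \<in> S \<Longrightarrow> u n \<noteq> 0"
  shows "card {n \<in> S. k \<le> multiplicity p (w n)}
    \<le> Suc (card {d \<in> {1..<M}. k \<le> multiplicity p (D\<^sup>2 * T d)})"
proof -
  let ?L = "{n \<in> S. k \<le> multiplicity p (w n)}"
  have fin: "finite ?L" using S finite_subset[of S] by auto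
  show ?thesis
  proof (cases "?L = {}")
    case False
    define n where "n = Min ?L"
    have n: "n \<in> ?L" "\<And>m. m \<in> ?L \<Longrightarrow> n \<le> m"
      unfolding n_def using Min_in[OF fin False] Min_le[OF fin] by auto
    have "(\<lambda>m. m - n) ` (?L - {n}) \<subseteq> {d \<in> {1..<M}. k \<le> multiplicity p (D\<^sup>2 * T d)}"
    proof (intro image_subsetI CollectI conjI)
      fix m assume m: "m \<in> ?L - {n}"
      have nm: "n < m" using n(2)[of m] m by auto
      have "n \<ge> 1" "c < n" "m \<le> c + M" using n(1) m S by auto
      then show "m - n \<in> {1..<M}" using nm by auto
      have "p ^ k dvd w n" "p ^ k dvd w m"
        using n(1) m by (auto intro: multiplicity_dvd')
      then have "p ^ k dvd D\<^sup>2 * T (m - n)"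
        using nm \<open>n \<ge> 1\<close> by (intro dvd_cross_prime[OF p, of n]) auto
      then show "k \<le> multiplicity p (D\<^sup>2 * T (m - n))"
        using p(1) D_nz T_nz[of "m - n"] nm by (intro multiplicity_geI) auto
    qed
    then have "card ((\<lambda>m. m - n) ` (?L - {n})) \<le> card {d \<in> {1..<M}. k \<le> multiplicity p (D\<^sup>2 * T d)}"
      by (intro card_mono) auto
    moreover have "inj_on (\<lambda>m. m - n) (?L - {n})"
      using n(2) by (intro inj_on_diff_nat) blast
    ultimately have "card (?L - {n}) \<le> card {d \<in> {1..<M}. k \<le> multiplicity p (D\<^sup>2 * T d)}"
      by (simp add: card_image)
    then show ?thesis using card.remove[OF fin n(1)] by simp
  next
    case True
    show ?thesis unfolding True by simp
  qed
qed

text \<open>R collects, for each prime of the product, one term of largest valuation. The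
  divisibility is checked prime by prime; it is stated for all J so that further terms can be
  discarded later.\<close>

lemma prod_w_dvd:
  assumes S: "S \<subseteq> {c<..c + M}" and u: "\<And>n. n \<in> S \<Longrightarrow> u n \<noteq> 0" and c: "c \<ge> 2 * nat \<bar>D\<bar>"
  shows "\<exists>R. R \<subseteq> S \<and> card R \<le> card (prime_factors (\<Prod>n\<in>S. u n)) \<and>
    (\<forall>J. J \<subseteq> S - R \<longrightarrow>
      (\<Prod>n\<in>J. w n) dvd (\<Prod>d=1..<M. D\<^sup>2 * T d) * (D ^ 4 * s') ^ card J)"
proof -
  have fin: "finite S" using S finite_subset by blast
  define P where "P = prime_factors (\<Prod>n\<in>S. u n)"
  have finP: "finite P" by (simp add: P_def)
  have nP: "(\<Prod>n\<in>S. u n) \<noteq> 0" using fin u by simp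
  have S1: "n \<ge> 1" "n \<ge> 2 * nat \<bar>D\<bar> + 1" if "n \<in> S" for n using that S c by auto
  have w: "w n \<noteq> 0" if "n \<in> S" for n using w_nz u S1 that by blast
  have "\<exists>n0. n0 \<in> S \<and> (\<forall>n\<in>S. multiplicity p (w n) \<le> multiplicity p (w n0))" if "p \<in> P" for p
  proof -
    have "S \<noteq> {}" using that by (auto simp: P_def)
    then have "Max ((\<lambda>n. multiplicity p (w n)) ` S) \<in> (\<lambda>n. multiplicity p (w n)) ` S"
      using fin by (intro Max_in) auto
    then show ?thesis using fin by (smt (verit) Max_ge finite_imageI image_iff)
  qed
  then obtain e where e: "\<And>p. p \<in> P \<Longrightarrow> e p \<in> S"
    "\<And>p n. p \<in> P \<Longrightarrow> n \<in> S \<Longrightarrow> multiplicity p (w n) \<le> multiplicity p (w (e p))"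
    by metis
  show ?thesis
  proof (intro exI[of _ "e ` P"] conjI allI impI)
    show "e ` P \<subseteq> S" using e(1) by auto
    show "card (e ` P) \<le> card (prime_factors (\<Prod>n\<in>S. u n))"
      unfolding P_def[symmetric] using finP by (rule card_image_le)
    fix J assume J: "J \<subseteq> S - e ` P"
    have finJ: "finite J" using J fin finite_subset by blast
    have wJ: "w n \<noteq> 0" if "n \<in> J" for n using w J that by blast
    let ?X = "\<Prod>d=1..<M. D\<^sup>2 * T d" and ?Y = "(D ^ 4 * s') ^ card J"
    have XY: "?X \<noteq> 0" "?Y \<noteq> 0" using D_nz T_nz s'_nz by auto
    show "(\<Prod>n\<in>J. w n) dvd ?X * ?Y"
    proof (rule multiplicity_le_imp_dvd)
      show "(\<Prod>n\<in>J. w n) \<noteq> 0" using finJ wJ by simp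
      fix p :: int assume p: "prime p"
      have L: "multiplicity p (\<Prod>n\<in>J. w n) = (\<Sum>n\<in>J. multiplicity p (w n))"
        using p finJ wJ by (intro prime_elem_multiplicity_prod_distrib) auto
      have R: "multiplicity p (?X * ?Y) = multiplicity p ?X + multiplicity p ?Y"
        using p XY by (intro prime_elem_multiplicity_mult_distrib) auto
      show "multiplicity p (\<Prod>n\<in>J. w n) \<le> multiplicity p (?X * ?Y)"
      proof (cases "p dvd s'")
        case True
        have "(\<Sum>n\<in>J. multiplicity p (w n)) \<le> (\<Sum>n\<in>J. 4 * multiplicity p D + 1)"
          using J S1 wJ by (intro sum_mono multiplicity_w_le[OF p True]) auto
        also have "\<dots> = card J * (4 * multiplicity p D + 1)" by simp
        \<comment> \<open>The summand 1 is absorbed because p divides s'; this explains the factor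
          \<open>D ^ 4 * s'\<close>.\<close>
        also have "\<dots> \<le> card J * (4 * multiplicity p D + multiplicity p s')"
          using True p s'_nz by (intro mult_left_mono add_left_mono multiplicity_geI) auto
        also have "\<dots> = multiplicity p ?Y"
          using p D_nz s'_nz prime_imp_prime_elem[OF p]
          by (simp add: prime_elem_multiplicity_power_distrib prime_elem_multiplicity_mult_distrib)
        finally show ?thesis using L R by simp
      next
        case False
        show ?thesis
        proof (cases "p \<in> P")
          case True
          have "(\<Sum>n\<in>J. multiplicity p (w n)) \<le> (\<Sum>n\<in>S - {e p}. multiplicity p (w n))"
            using J True fin by (intro sum_mono2) auto
          also have "\<dots> \<le> (\<Sum>d=1..<M. multiplicity p (D\<^sup>2 * T d))"
            using fin e[OF True] card_levels_le[OF p False S u] by (intro sum_remove_max_le) auto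
          also have "\<dots> = multiplicity p ?X"
            using p D_nz T_nz by (intro prime_elem_multiplicity_prod_distrib[symmetric]) auto
          finally show ?thesis using L R by simp
        next
          case False
          have "\<not> p dvd w n" if "n \<in> J" for n
          proof
            assume "p dvd w n"
            then have "p dvd (u n)\<^sup>2" using w_dvd[of n] S1 J that dvd_trans by blast
            then have "p dvd u n" using p prime_dvd_power by blast
            moreover have "u n dvd (\<Prod>n\<in>S. u n)" using that J fin by (intro dvd_prodI) auto
            ultimately have "p dvd (\<Prod>n\<in>S. u n)" using dvd_trans by blast
            then show False using p nP False by (simp add: P_def prime_factors_dvd)
          qed
          then have "(\<Sum>n\<in>J. multiplicity p (w n)) = 0"
            by (simp add: not_dvd_imp_multiplicity_0)
          then show ?thesis using L by simp
        qed
      qed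
    qed
  qed
qed

end

subsection \<open>Sizes\<close>

text \<open>The ratio z = \<alpha> / \<beta> satisfies z + 1/z = c - 2, one of -2, -1, 0, 1, so it
  is a root of unity of order 2, 3, 4 or 6 (for \<beta> \<noteq> 0).\<close>

lemma roots_of_unity_ratio:
  fixes \<alpha> \<beta> :: complex and c :: int
  assumes eq: "\<alpha>\<^sup>2 + \<beta>\<^sup>2 = of_int (c - 2) * (\<alpha> * \<beta>)" and c: "0 \<le> c" "c < 4"
  shows "\<exists>k>0. \<alpha> ^ k = \<beta> ^ k"
proof -
  consider "c = 0" | "c = 1" | "c = 2" | "c = 3" using c by linarith
  then show ?thesis
  proof cases
    case 1
    then have "\<alpha>\<^sup>2 + \<beta>\<^sup>2 + 2 * (\<alpha> * \<beta>) = 0" using eq by simp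
    then have "(\<alpha> + \<beta>)\<^sup>2 = 0" by (simp add: power2_sum mult.assoc)
    then have "\<alpha> ^ 2 = \<beta> ^ 2" by (simp add: add_eq_0_iff power2_commute)
    then show ?thesis by (intro exI[of _ 2]) simp
  next
    case 2
    then have e: "\<alpha>\<^sup>2 + \<beta>\<^sup>2 + \<alpha> * \<beta> = 0" using eq by simp
    have "\<alpha> ^ 3 - \<beta> ^ 3 = (\<alpha> - \<beta>) * (\<alpha>\<^sup>2 + \<beta>\<^sup>2 + \<alpha> * \<beta>)"
      by (simp add: power2_eq_square power3_eq_cube algebra_simps)
    then have "\<alpha> ^ 3 = \<beta> ^ 3" using e by simp
    then show ?thesis by (intro exI[of _ 3]) simp
  next
    case 3
    then have e: "\<alpha>\<^sup>2 + \<beta>\<^sup>2 = 0" using eq by simp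
    have "\<alpha> ^ 4 - \<beta> ^ 4 = (\<alpha>\<^sup>2 - \<beta>\<^sup>2) * (\<alpha>\<^sup>2 + \<beta>\<^sup>2)"
      by (simp add: power2_eq_square power4_eq_xxxx algebra_simps)
    then have "\<alpha> ^ 4 = \<beta> ^ 4" using e by simp
    then show ?thesis by (intro exI[of _ 4]) simp
  next
    case 4
    then have e: "\<alpha>\<^sup>2 + \<beta>\<^sup>2 - \<alpha> * \<beta> = 0" using eq by simp
    have "\<alpha> ^ 3 + \<beta> ^ 3 = (\<alpha> + \<beta>) * (\<alpha>\<^sup>2 + \<beta>\<^sup>2 - \<alpha> * \<beta>)"
      by (simp add: power2_eq_square power3_eq_cube algebra_simps)
    then have "\<alpha> ^ 3 = - (\<beta> ^ 3)" using e by (simp add: add_eq_0_iff2)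
    then have "(\<alpha> ^ 3) ^ 2 = (\<beta> ^ 3) ^ 2" by simp
    then show ?thesis by (intro exI[of _ 6]) (simp flip: power_mult)
  qed
qed

section \<open>The roots and the growth rate \<open>l\<close>\<close>

text \<open>The order of the absolute values costs no generality: the data are symmetric under
  exchanging (\<alpha>, a) with (\<beta>, b).\<close>

locale dominant_recurrence = binary_recurrence +
  fixes \<alpha> \<beta> a b :: complex
  assumes sum_roots: "\<alpha> + \<beta> = of_int r" and prod_roots: "\<alpha> * \<beta> = - of_int s"
    and roots_neq: "\<alpha> \<noteq> \<beta>" and dominant: "cmod \<beta> \<le> cmod \<alpha>"
    and roots_nz: "\<alpha> \<noteq> 0" "\<beta> \<noteq> 0" and coeffs_nz: "a \<noteq> 0" "b \<noteq> 0"
    and not_root_of_unity: "\<And>k. k > 0 \<Longrightarrow> \<alpha> ^ k \<noteq> \<beta> ^ k"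
    and init: "of_int (u 0) = a + b" "of_int (u 1) = a * \<alpha> + b * \<beta>"
begin

lemma root_square: "\<alpha>\<^sup>2 = of_int r * \<alpha> + of_int s" "\<beta>\<^sup>2 = of_int r * \<beta> + of_int s"
proof -
  have "of_int r * \<alpha> = \<alpha>\<^sup>2 + \<alpha> * \<beta>" "of_int r * \<beta> = \<beta>\<^sup>2 + \<alpha> * \<beta>"
    unfolding sum_roots[symmetric] by (simp_all add: power2_eq_square algebra_simps)
  then show "\<alpha>\<^sup>2 = of_int r * \<alpha> + of_int s" "\<beta>\<^sup>2 = of_int r * \<beta> + of_int s"
    using prod_roots by simp_all
qed

lemma root_power:
  "\<alpha> ^ Suc (Suc n) = of_int r * \<alpha> ^ Suc n + of_int s * \<alpha> ^ n"
  "\<beta> ^ Suc (Suc n) = of_int r * \<beta> ^ Suc n + of_int s * \<beta> ^ n"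
proof -
  have "\<alpha> ^ Suc (Suc n) = \<alpha>\<^sup>2 * \<alpha> ^ n" "\<beta> ^ Suc (Suc n) = \<beta>\<^sup>2 * \<beta> ^ n"
    by (simp_all add: power2_eq_square)
  then show "\<alpha> ^ Suc (Suc n) = of_int r * \<alpha> ^ Suc n + of_int s * \<alpha> ^ n"
    "\<beta> ^ Suc (Suc n) = of_int r * \<beta> ^ Suc n + of_int s * \<beta> ^ n"
    unfolding root_square by (simp_all add: algebra_simps)
qed

lemma binet: "of_int (u n) = a * \<alpha> ^ n + b * \<beta> ^ n"
proof (induction n rule: induct_nat_012)
  case (ge2 n)
  show ?case unfolding u_rec root_power of_int_add of_int_mult ge2
    by (simp add: algebra_simps)
qed (use init in simp_all)

lemma lucas_binet: "of_int (lucas r s n) * (\<alpha> - \<beta>) = \<alpha> ^ n - \<beta> ^ n"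
proof (induction n rule: induct_nat_012)
  case (ge2 n)
  have "of_int (lucas r s (Suc (Suc n))) * (\<alpha> - \<beta>)
    = of_int r * (of_int (lucas r s (Suc n)) * (\<alpha> - \<beta>)) + of_int s * (of_int (lucas r s n) * (\<alpha> - \<beta>))"
    by (simp add: algebra_simps)
  then show ?case unfolding root_power ge2 by (simp add: algebra_simps)
qed simp_all

lemma of_int_D: "(of_int D :: complex) = - (\<alpha> - \<beta>)\<^sup>2 * a * b"
proof -
  have "(of_int D :: complex)
      = (of_int (u 1))\<^sup>2 - (\<alpha> + \<beta>) * of_int (u 1) * of_int (u 0) - (- (\<alpha> * \<beta>)) * (of_int (u 0))\<^sup>2"
    unfolding D_def using sum_roots prod_roots by simp
  also have "\<dots> = - (\<alpha> - \<beta>)\<^sup>2 * a * b"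
    unfolding init by (simp add: power2_eq_square algebra_simps)
  finally show ?thesis .
qed

sublocale proper_recurrence
proof
  have "(of_int s :: complex) \<noteq> 0" using prod_roots roots_nz
    by (metis add.inverse_inverse minus_zero mult_eq_0_iff)
  then show "s \<noteq> 0" by auto
  have "(of_int D :: complex) \<noteq> 0" unfolding of_int_D using roots_neq coeffs_nz by simp
  then show "D \<noteq> 0" by auto
  fix d :: nat assume "d \<ge> 1"
  then have "of_int (lucas r s d) * (\<alpha> - \<beta>) \<noteq> 0"
    unfolding lucas_binet using not_root_of_unity[of d] by simp
  then show "lucas r s d \<noteq> 0" by auto
qed

lemma discriminant: "(\<alpha> - \<beta>)\<^sup>2 = of_int (r\<^sup>2 + 4 * s)"
proof -
  have "(\<alpha> - \<beta>)\<^sup>2 = (\<alpha> + \<beta>)\<^sup>2 - 4 * (\<alpha> * \<beta>)" by (simp add: power2_eq_square algebra_simps)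
  then show ?thesis using sum_roots prod_roots by simp
qed

lemma discriminant_nz: "r\<^sup>2 + 4 * s \<noteq> 0"
proof
  assume "r\<^sup>2 + 4 * s = 0"
  then have "(\<alpha> - \<beta>)\<^sup>2 = 0" using discriminant by (simp only: of_int_0)
  then show False using roots_neq by simp
qed

text \<open>The square of \<alpha> - \<beta> is the discriminant, a nonzero integer.\<close>

lemma norm_roots_diff: "cmod (\<alpha> - \<beta>) \<ge> 1"
proof -
  have "1 \<le> \<bar>r\<^sup>2 + 4 * s\<bar>" using discriminant_nz by linarith
  then have "1 \<le> real_of_int \<bar>r\<^sup>2 + 4 * s\<bar>" by (simp only: of_int_1_le_iff)
  also have "\<dots> = (cmod (\<alpha> - \<beta>))\<^sup>2"
    unfolding norm_power[symmetric] discriminant norm_of_int of_int_abs ..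
  finally show ?thesis by (simp add: power2_nonneg_ge_1_iff)
qed

lemma norm_prod: "cmod \<alpha> * cmod \<beta> = real_of_int \<bar>s\<bar>"
  using arg_cong[OF prod_roots, of cmod] by (simp add: norm_mult)

lemma norm_ge_1: "cmod \<alpha> \<ge> 1"
proof -
  have "1 \<le> real_of_int \<bar>s\<bar>" using s_nz by linarith
  also have "\<dots> \<le> cmod \<alpha> * cmod \<alpha>"
    unfolding norm_prod[symmetric] using dominant by (intro mult_left_mono) auto
  finally show ?thesis by (simp add: power2_nonneg_ge_1_iff flip: power2_eq_square)
qed

text \<open>\<open>t d\<close> is a sum of d monomials of degree d - 1 in the two roots.\<close>

lemma norm_lucas_le:
  assumes "d \<ge> 1"
  shows "\<bar>real_of_int (t d)\<bar> \<le> real d * cmod \<alpha> ^ (d - 1)"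
proof -
  have "of_int (t d) * (\<alpha> - \<beta>) = (\<alpha> - \<beta>) * (\<Sum>i<d. \<beta> ^ (d - Suc i) * \<alpha> ^ i)"
    unfolding t_def lucas_binet by (rule power_diff_sumr2)
  then have "of_int (t d) = (\<Sum>i<d. \<beta> ^ (d - Suc i) * \<alpha> ^ i)"
    using roots_neq by simp
  then have "\<bar>real_of_int (t d)\<bar> = cmod (\<Sum>i<d. \<beta> ^ (d - Suc i) * \<alpha> ^ i)"
    by (metis norm_of_int)
  also have "\<dots> \<le> (\<Sum>i<d. cmod \<alpha> ^ (d - 1))"
  proof (rule sum_norm_le)
    fix i assume "i \<in> {..<d}"
    then have "d - 1 = (d - Suc i) + i" by auto
    then have e: "cmod \<alpha> ^ (d - 1) = cmod \<alpha> ^ (d - Suc i) * cmod \<alpha> ^ i"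
      by (simp only: power_add)
    show "cmod (\<beta> ^ (d - Suc i) * \<alpha> ^ i) \<le> cmod \<alpha> ^ (d - 1)"
      unfolding e norm_mult norm_power
      using dominant by (intro mult_right_mono power_mono) auto
  qed
  finally show ?thesis by simp
qed

lemma g_le_s: "real_of_int g \<le> real_of_int \<bar>s\<bar>"
proof -
  have "g \<le> \<bar>s\<bar>" using g_dvd(2) s_nz dvd_imp_le_int[of s g] by linarith
  then show ?thesis by (simp only: of_int_le_iff)
qed

text \<open>For real roots x and y, |x| - |y| is the smaller of |x + y| and |x - y|. Both are at
  least 1: the first is |r| with r \<noteq> 0, as otherwise \<alpha>^2 = \<beta>^2. It remains to
  multiply by |x|.\<close>

lemma norm_sq_ge_real:
  assumes "r\<^sup>2 + 4 * s > 0"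
  shows "real_of_int \<bar>s\<bar> + cmod \<alpha> \<le> (cmod \<alpha>)\<^sup>2"
proof -
  define e where "e = sqrt (real_of_int (r\<^sup>2 + 4 * s))"
  have e2: "e\<^sup>2 = real_of_int (r\<^sup>2 + 4 * s)"
    unfolding e_def using assms by (intro real_sqrt_pow2) linarith
  have "(\<alpha> - \<beta>)\<^sup>2 = (of_real e)\<^sup>2"
    using e2 unfolding discriminant of_real_power[symmetric] by (simp only: of_real_of_int_eq)
  then have "\<alpha> - \<beta> = of_real e \<or> \<alpha> - \<beta> = - of_real e" by (simp add: power2_eq_iff)
  then have "Im (\<alpha> - \<beta>) = 0"
    by (elim disjE) (simp_all only: Im_complex_of_real uminus_complex.sel minus_zero)
  moreover have "Im (\<alpha> + \<beta>) = 0" unfolding sum_roots by simp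
  ultimately have im: "Im \<alpha> = 0" "Im \<beta> = 0" by auto
  define x y where "x = Re \<alpha>" and "y = Re \<beta>"
  have xy: "\<alpha> = of_real x" "\<beta> = of_real y"
    using im by (auto simp: x_def y_def complex_eq_iff)
  have n: "cmod \<alpha> = \<bar>x\<bar>" "cmod \<beta> = \<bar>y\<bar>" unfolding xy by simp_all
  have sm: "x + y = real_of_int r"
    using arg_cong[OF sum_roots, of Re] by (simp add: x_def y_def)
  have r: "r \<noteq> 0"
  proof
    assume "r = 0"
    then have "\<alpha> = - \<beta>" using sum_roots by (simp add: add_eq_0_iff2)
    then have "\<alpha> ^ 2 = \<beta> ^ 2" by simp
    then show False using not_root_of_unity[of 2] by simp
  qed
  have "\<bar>x + y\<bar> \<ge> 1" unfolding sm using r by linarith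
  moreover have "\<bar>x - y\<bar> \<ge> 1" using norm_roots_diff unfolding xy by (simp flip: of_real_diff)
  ultimately have "\<bar>x\<bar> - \<bar>y\<bar> \<ge> 1" using dominant unfolding n by linarith
  then have "\<bar>x\<bar> * (\<bar>x\<bar> - \<bar>y\<bar>) \<ge> \<bar>x\<bar> * 1" by (intro mult_left_mono) auto
  then show ?thesis
    unfolding norm_prod[symmetric] n power2_eq_square by (simp add: algebra_simps)
qed

text \<open>The roots are complex conjugates, so |\<alpha>|^2 = |\<alpha> \<beta>|.\<close>

lemma norm_sq_complex:
  assumes "r\<^sup>2 + 4 * s < 0"
  shows "(cmod \<alpha>)\<^sup>2 = real_of_int \<bar>s\<bar>"
proof -
  define e where "e = sqrt (real_of_int (- (r\<^sup>2 + 4 * s)))"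
  have "e\<^sup>2 = real_of_int (- (r\<^sup>2 + 4 * s))"
    unfolding e_def using assms by (intro real_sqrt_pow2) linarith
  then have e2: "real_of_int (r\<^sup>2 + 4 * s) = - (e\<^sup>2)" by simp
  have "(\<alpha> - \<beta>)\<^sup>2 = - ((of_real e)\<^sup>2)"
    using arg_cong[OF e2, of complex_of_real] unfolding discriminant
    by (simp only: of_real_of_int_eq of_real_minus of_real_power)
  also have "\<dots> = (\<i> * of_real e)\<^sup>2" by (simp add: power_mult_distrib)
  finally have "\<alpha> - \<beta> = \<i> * of_real e \<or> \<alpha> - \<beta> = - (\<i> * of_real e)"
    by (simp add: power2_eq_iff)
  then have "Re (\<alpha> - \<beta>) = 0"
    by (elim disjE) (simp_all only: Re_i_times Im_complex_of_real uminus_complex.sel minus_zero)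
  moreover have "Im (\<alpha> + \<beta>) = 0" unfolding sum_roots by simp
  ultimately have "\<beta> = cnj \<alpha>" by (auto simp: complex_eq_iff)
  then have "cmod \<beta> = cmod \<alpha>" by simp
  then show ?thesis using norm_prod by (simp add: power2_eq_square)
qed

text \<open>If |s'| = 1, then -s = g divides r^2, and the quotient c satisfies 0 \<le> c < 4 by the
  negative discriminant. Then \<open>roots_of_unity_ratio\<close> contradicts
  non-degeneracy.\<close>

lemma abs_s'_ge_2:
  assumes "r\<^sup>2 + 4 * s < 0"
  shows "\<bar>s'\<bar> \<ge> 2"
proof (rule ccontr)
  assume "\<not> ?thesis"
  with s'_nz have "s' = 1 \<or> s' = -1" by linarith
  then have "s = g \<or> s = - g" using s_eq by (metis mult.right_neutral mult_minus_right)
  moreover have "s < 0" using assms zero_le_power2[of r] by linarith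
  ultimately have sg: "- s = g" using g_pos by linarith
  define c where "c = r\<^sup>2 div g"
  have rc: "r\<^sup>2 = g * c" using g_dvd(1) by (simp add: c_def)
  have "r\<^sup>2 < 4 * (- s)" using assms by linarith
  then have "g * c < g * 4" unfolding rc sg by (simp only: mult.commute)
  then have c4: "c < 4" using g_pos by simp
  have c0: "c \<ge> 0" using g_pos by (simp add: c_def pos_imp_zdiv_nonneg_iff)
  have "\<alpha>\<^sup>2 + \<beta>\<^sup>2 = (\<alpha> + \<beta>)\<^sup>2 - 2 * (\<alpha> * \<beta>)" by (simp add: power2_eq_square algebra_simps)
  also have "\<dots> = of_int (r\<^sup>2 + 2 * s)" using sum_roots prod_roots by simp
  also have "r\<^sup>2 + 2 * s = (c - 2) * (- s)"
  proof -
    have s2: "2 * s = - 2 * g" using sg by linarith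
    show ?thesis unfolding rc sg s2 by (simp add: algebra_simps)
  qed
  also have "of_int ((c - 2) * (- s)) = of_int (c - 2) * (\<alpha> * \<beta>)"
    using prod_roots by simp
  finally show False
    using roots_of_unity_ratio[OF _ c0 c4] not_root_of_unity by blast
qed

text \<open>This makes \<open>l\<close> positive, with an explicit lower bound.\<close>

lemma norm_sq_ge: "real_of_int g * (1 + 1 / cmod \<alpha>) \<le> (cmod \<alpha>)\<^sup>2"
proof -
  have A: "cmod \<alpha> \<ge> 1" by (rule norm_ge_1)
  have g0: "real_of_int g \<ge> 1" using g_pos by simp
  consider "r\<^sup>2 + 4 * s > 0" | "r\<^sup>2 + 4 * s < 0" using discriminant_nz by linarith
  then show ?thesis
  proof cases
    case 1
    \<comment> \<open>Once |\<alpha>|^2 \<ge> g + |\<alpha>| is known, g \<le> |\<alpha>|^2 gives g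
      / |\<alpha>| \<le> |\<alpha>|.\<close>
    from norm_sq_ge_real[OF 1] have ge: "real_of_int g + cmod \<alpha> \<le> (cmod \<alpha>)\<^sup>2" using g_le_s by linarith
    then have "real_of_int g \<le> (cmod \<alpha>)\<^sup>2" using A by linarith
    then have "real_of_int g / cmod \<alpha> \<le> cmod \<alpha>"
      using A by (simp add: divide_le_eq power2_eq_square)
    then show ?thesis using ge by (simp add: algebra_simps)
  next
    case 2
    \<comment> \<open>Here |\<alpha>|^2 = |s| = g |s'| \<ge> 2 g.\<close>
    have "real_of_int g * (1 + 1 / cmod \<alpha>) \<le> real_of_int g * 2"
      using A g0 roots_nz(1) by (intro mult_left_mono) (auto simp: divide_le_eq)
    also have "\<dots> \<le> real_of_int g * real_of_int \<bar>s'\<bar>"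
      using abs_s'_ge_2[OF 2] g0 by (intro mult_left_mono) auto
    also have "\<dots> = real_of_int \<bar>s\<bar>"
    proof -
      have "\<bar>s\<bar> = g * \<bar>s'\<bar>" using arg_cong[OF s_eq, of abs] g_pos by (simp add: abs_mult)
      then show ?thesis by simp
    qed
    finally show ?thesis using norm_sq_complex[OF 2] by simp
  qed
qed

definition l :: real where "l = ln ((cmod \<alpha>)\<^sup>2 / real_of_int g)"

lemma l_eq: "l = 2 * ln (cmod \<alpha>) - ln (real_of_int g)"
  using norm_ge_1 g_pos unfolding l_def by (subst ln_div) (auto simp: ln_realpow)

text \<open>This is ln (1 + x) \<ge> x / (1 + x) at x = 1 / |\<alpha>|, combined with
  \<open>norm_sq_ge\<close>.\<close>

lemma l_ge: "l \<ge> 1 / (cmod \<alpha> + 1)"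
proof -
  let ?A = "cmod \<alpha>"
  have A: "?A \<ge> 1" by (rule norm_ge_1)
  have pos: "1 + 1 / ?A > 0" using A by (intro add_pos_nonneg) auto
  have "1 / (?A + 1) = 1 - inverse (1 + 1 / ?A)"
  proof -
    have "1 + 1 / ?A = (?A + 1) / ?A" using roots_nz(1) by (simp add: add_divide_distrib)
    then show ?thesis using A roots_nz(1) by (simp add: diff_divide_eq_iff)
  qed
  also have "\<dots> \<le> - ln (inverse (1 + 1 / ?A))"
    using ln_le_minus_one[of "inverse (1 + 1 / ?A)"] pos by simp
  also have "\<dots> = ln (1 + 1 / ?A)" using pos by (subst ln_inverse) auto
  also have "\<dots> \<le> l" unfolding l_def
    using norm_sq_ge pos g_pos by (intro ln_mono) (auto simp: le_divide_eq mult.commute)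
  finally show ?thesis .
qed

section \<open>Archimedean size of the terms\<close>

text \<open>Eliminating b \<beta>^n gives u(n+d) - \<beta>^d u(n) = a \<alpha>^n t(d) (\<alpha> -
  \<beta>), and the last two factors have absolute value at least 1. So two nearby terms cannot both
  be small.\<close>

lemma norm_leading_coeff_le:
  assumes d: "d \<ge> 1"
  shows "cmod a * cmod \<alpha> ^ n \<le> \<bar>real_of_int (u (n + d))\<bar> + cmod \<alpha> ^ d * \<bar>real_of_int (u n)\<bar>"
proof -
  have "1 \<le> \<bar>real_of_int (t d)\<bar>" using lucas_nz[OF d] by (simp add: t_def)
  then have "1 \<le> \<bar>real_of_int (t d)\<bar> * cmod (\<alpha> - \<beta>)"
    using norm_roots_diff by (meson mult_ge1_I)
  then have "cmod a * cmod \<alpha> ^ n * 1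
      \<le> cmod a * cmod \<alpha> ^ n * (\<bar>real_of_int (t d)\<bar> * cmod (\<alpha> - \<beta>))"
    by (intro mult_left_mono) auto
  also have "\<dots> = cmod (a * \<alpha> ^ n * (of_int (t d) * (\<alpha> - \<beta>)))"
    by (simp add: norm_mult norm_power)
  also have "a * \<alpha> ^ n * (of_int (t d) * (\<alpha> - \<beta>)) = of_int (u (n + d)) - \<beta> ^ d * of_int (u n)"
    unfolding t_def lucas_binet binet by (simp add: power_add algebra_simps)
  also have "cmod \<dots> \<le> cmod (of_int (u (n + d))) + cmod (\<beta> ^ d * of_int (u n))"
    by (rule norm_triangle_ineq4)
  also have "\<dots> = \<bar>real_of_int (u (n + d))\<bar> + cmod \<beta> ^ d * \<bar>real_of_int (u n)\<bar>"
    by (simp add: norm_mult norm_power)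
  also have "\<dots> \<le> \<bar>real_of_int (u (n + d))\<bar> + cmod \<alpha> ^ d * \<bar>real_of_int (u n)\<bar>"
    using dominant by (intro add_left_mono mult_right_mono power_mono) auto
  finally show ?thesis by simp
qed

text \<open>At a distance d < K, inserting both smallness bounds into
  \<open>norm_leading_coeff_le\<close> would give |\<alpha>|^K < |\<alpha>|^d.\<close>

lemma small_terms_separated:
  assumes small: "2 * cmod \<alpha> ^ K * \<bar>real_of_int (u n)\<bar> < cmod a * cmod \<alpha> ^ n"
    "2 * cmod \<alpha> ^ K * \<bar>real_of_int (u m)\<bar> < cmod a * cmod \<alpha> ^ m" and nm: "n < m"
  shows "K \<le> m - n"
proof (rule ccontr)
  let ?A = "cmod \<alpha>"
  assume "\<not> ?thesis"
  define d where "d = m - n"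
  have m: "m = n + d" "d \<ge> 1" "d \<le> K" using nm \<open>\<not> K \<le> m - n\<close> by (auto simp: d_def)
  have A: "?A \<ge> 1" by (rule norm_ge_1)
  have "2 * ?A ^ K * (cmod a * ?A ^ n)
      \<le> 2 * ?A ^ K * (\<bar>real_of_int (u m)\<bar> + ?A ^ d * \<bar>real_of_int (u n)\<bar>)"
    unfolding m using norm_leading_coeff_le[OF m(2)] by (intro mult_left_mono) auto
  also have "\<dots> = 2 * ?A ^ K * \<bar>real_of_int (u m)\<bar> + ?A ^ d * (2 * ?A ^ K * \<bar>real_of_int (u n)\<bar>)"
    by (simp add: algebra_simps)
  also have "\<dots> < cmod a * ?A ^ m + ?A ^ d * (cmod a * ?A ^ n)"
    using small A by (intro add_less_le_mono mult_left_mono) auto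
  also have "\<dots> = 2 * ?A ^ d * (cmod a * ?A ^ n)" by (simp add: m power_add algebra_simps)
  also have "\<dots> \<le> 2 * ?A ^ K * (cmod a * ?A ^ n)"
    using A m(3) by (intro mult_right_mono mult_left_mono power_increasing) auto
  finally show False by simp
qed

lemma ln_T_le:
  assumes d: "d \<ge> 1"
  shows "ln \<bar>real_of_int (T d)\<bar> \<le> 2 * ln (real d) + (real d - 1) * l"
proof -
  let ?A = "cmod \<alpha>" and ?G = "real_of_int g"
  have G: "?G \<ge> 1" using g_pos by simp
  have A: "?A \<ge> 1" by (rule norm_ge_1)
  have e: "?G ^ (d - 1) * real_of_int (T d) = (real_of_int (t d))\<^sup>2"
    using arg_cong[OF g_power_mult_T[OF d], of real_of_int] by simp
  have "?G ^ (d - 1) * \<bar>real_of_int (T d)\<bar> = \<bar>?G ^ (d - 1) * real_of_int (T d)\<bar>"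
    using G by (simp add: abs_mult)
  also have "\<dots> = \<bar>real_of_int (t d)\<bar>\<^sup>2" unfolding e by simp
  also have "\<dots> \<le> (real d * ?A ^ (d - 1))\<^sup>2"
    using norm_lucas_le[OF d] by (intro power_mono) auto
  finally have le: "?G ^ (d - 1) * \<bar>real_of_int (T d)\<bar> \<le> (real d * ?A ^ (d - 1))\<^sup>2" .
  have T0: "\<bar>real_of_int (T d)\<bar> > 0" using T_nz[OF d] by simp
  have "(real d - 1) * ln ?G + ln \<bar>real_of_int (T d)\<bar> = ln (?G ^ (d - 1) * \<bar>real_of_int (T d)\<bar>)"
    using G T0 d by (subst ln_mult) (auto simp: ln_realpow of_nat_diff)
  also have "\<dots> \<le> ln ((real d * ?A ^ (d - 1))\<^sup>2)"
    using le G T0 d A by (subst ln_le_cancel_iff) (auto intro!: mult_pos_pos simp: zero_less_power)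
  also have "\<dots> = 2 * (ln (real d) + (real d - 1) * ln ?A)"
  proof -
    have "ln ((real d * ?A ^ (d - 1))\<^sup>2) = 2 * ln (real d * ?A ^ (d - 1))"
      using A d by (subst ln_realpow) auto
    also have "ln (real d * ?A ^ (d - 1)) = ln (real d) + ln (?A ^ (d - 1))"
      using A d by (subst ln_mult) auto
    also have "ln (?A ^ (d - 1)) = (real d - 1) * ln ?A"
      using A d by (subst ln_realpow) (auto simp: of_nat_diff)
    finally show ?thesis .
  qed
  finally show ?thesis unfolding l_eq by (simp add: algebra_simps)
qed

text \<open>The logarithm of the hypothesis, doubled; the final 2 bounds 2 ln 2, and one nonnegative
  ln g is given away.\<close>

lemma ln_w_ge:
  assumes n: "n \<ge> 1" and large: "cmod a * cmod \<alpha> ^ n \<le> 2 * cmod \<alpha> ^ K * \<bar>real_of_int (u n)\<bar>"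
  shows "real n * l + 2 * ln (cmod a) - 2 * real K * ln (cmod \<alpha>) - 2 \<le> ln \<bar>real_of_int (w n)\<bar>"
proof -
  let ?A = "cmod \<alpha>" and ?G = "real_of_int g"
  have G: "?G \<ge> 1" using g_pos by simp
  have A: "?A \<ge> 1" by (rule norm_ge_1)
  have a0: "cmod a > 0" using coeffs_nz by simp
  have "0 < cmod a * ?A ^ n" using a0 A by (intro mult_pos_pos zero_less_power) auto
  then have u0: "u n \<noteq> 0" using large by auto
  then have w0: "\<bar>real_of_int (w n)\<bar> > 0" using w_nz[OF n] by simp
  have e: "?G ^ (n - 1) * real_of_int (w n) = (real_of_int (u n))\<^sup>2"
    using arg_cong[OF g_power_mult_w[OF n], of real_of_int] by simp
  have lu: "2 * ln \<bar>real_of_int (u n)\<bar> = (real n - 1) * ln ?G + ln \<bar>real_of_int (w n)\<bar>"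
  proof -
    have "2 * ln \<bar>real_of_int (u n)\<bar> = ln (\<bar>real_of_int (u n)\<bar>\<^sup>2)"
      using u0 by (subst ln_realpow) auto
    also have "\<bar>real_of_int (u n)\<bar>\<^sup>2 = ?G ^ (n - 1) * \<bar>real_of_int (w n)\<bar>"
      using arg_cong[OF e, of abs] G by (simp add: abs_mult)
    also have "ln \<dots> = ln (?G ^ (n - 1)) + ln \<bar>real_of_int (w n)\<bar>"
      using G w0 by (subst ln_mult) auto
    also have "ln (?G ^ (n - 1)) = (real n - 1) * ln ?G"
      using G n by (subst ln_realpow) (auto simp: of_nat_diff)
    finally show ?thesis .
  qed
  have "ln (cmod a) + real n * ln ?A = ln (cmod a * ?A ^ n)"
    using a0 A by (subst ln_mult) (auto simp: ln_realpow)
  also have "\<dots> \<le> ln (2 * ?A ^ K * \<bar>real_of_int (u n)\<bar>)"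
    using large \<open>0 < cmod a * ?A ^ n\<close> by (intro ln_mono)
  also have "\<dots> = ln 2 + real K * ln ?A + ln \<bar>real_of_int (u n)\<bar>"
    using A u0 roots_nz(1) by (simp add: ln_mult ln_realpow)
  finally have "2 * (ln (cmod a) + real n * ln ?A)
      \<le> 2 * ln 2 + 2 * real K * ln ?A + ((real n - 1) * ln ?G + ln \<bar>real_of_int (w n)\<bar>)"
    unfolding lu[symmetric] by simp
  moreover have "ln 2 \<le> (1::real)" using ln_le_minus_one[of 2] by simp
  moreover have "(real n - 1) * ln ?G \<le> real n * ln ?G"
    using G by (intro mult_right_mono) auto
  ultimately show ?thesis unfolding l_eq by (simp add: algebra_simps)
qed

section \<open>Bounds polynomial in the data\<close>

lemma norm_root_le:
  assumes "B \<ge> 0" "\<bar>real_of_int r\<bar> \<le> B" "\<bar>real_of_int s\<bar> \<le> B"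
  shows "cmod \<alpha> \<le> B + 1"
proof (rule ccontr)
  assume gt: "\<not> ?thesis"
  have "(cmod \<alpha>)\<^sup>2 = cmod (of_int r * \<alpha> + of_int s)"
    using root_square(1) by (metis norm_power)
  also have "\<dots> \<le> \<bar>real_of_int r\<bar> * cmod \<alpha> + \<bar>real_of_int s\<bar>"
    using norm_triangle_ineq[of "of_int r * \<alpha>" "of_int s"] by (simp add: norm_mult)
  also have "\<dots> \<le> B * cmod \<alpha> + B" using assms by (intro add_mono mult_right_mono) auto
  also have "\<dots> < B * cmod \<alpha> + cmod \<alpha>" using gt by simp
  also have "\<dots> = (B + 1) * cmod \<alpha>" by (simp add: algebra_simps)
  also have "\<dots> \<le> cmod \<alpha> * cmod \<alpha>" using gt by (intro mult_right_mono) auto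
  finally show False by (simp add: power2_eq_square)
qed

lemma abs_D_le:
  assumes B: "B \<ge> 1" "\<bar>real_of_int r\<bar> \<le> B" "\<bar>real_of_int s\<bar> \<le> B"
    "\<bar>real_of_int (u 0)\<bar> \<le> B" "\<bar>real_of_int (u 1)\<bar> \<le> B"
  shows "\<bar>real_of_int D\<bar> \<le> 3 * B ^ 3"
proof -
  have "\<bar>real_of_int D\<bar> \<le> \<bar>real_of_int (u 1)\<bar>\<^sup>2 + \<bar>real_of_int r\<bar> * \<bar>real_of_int (u 1)\<bar> * \<bar>real_of_int (u 0)\<bar>
      + \<bar>real_of_int s\<bar> * \<bar>real_of_int (u 0)\<bar>\<^sup>2"
  proof -
    have tri: "\<bar>x - y - z\<bar> \<le> \<bar>x\<bar> + \<bar>y\<bar> + \<bar>z\<bar>" for x y z :: real by linarith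
    show ?thesis
      unfolding D_def of_int_diff by (rule order_trans[OF tri]) (simp add: abs_mult)
  qed
  also have "\<dots> \<le> B\<^sup>2 + B * B * B + B * B\<^sup>2"
    using B by (intro add_mono mult_mono power_mono) auto
  finally have "\<bar>real_of_int D\<bar> \<le> B\<^sup>2 + B * B * B + B * B\<^sup>2" .
  moreover have "B\<^sup>2 \<le> B ^ 3" using B(1) by (intro power_increasing) auto
  moreover have "B * B * B = B ^ 3" "B * B\<^sup>2 = B ^ 3"
    by (simp_all add: power2_eq_square power3_eq_cube)
  ultimately show ?thesis by linarith
qed

text \<open>The nonzero integer D factors as a (\<alpha> - \<beta>) times u(1) - \<alpha> u(0), so
  upper bounds for the cofactors of a bound |a| from below.\<close>

lemma norm_coeff_ge:
  assumes B: "B \<ge> 1" "\<bar>real_of_int r\<bar> \<le> B" "\<bar>real_of_int s\<bar> \<le> B"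
    "\<bar>real_of_int (u 0)\<bar> \<le> B" "\<bar>real_of_int (u 1)\<bar> \<le> B"
  shows "1 / (12 * B ^ 3) \<le> cmod a"
proof -
  have A: "cmod \<alpha> \<le> 2 * B" using norm_root_le[of B] B by linarith
  have "1 \<le> \<bar>real_of_int D\<bar>" using D_nz by linarith
  also have "\<dots> = cmod (of_int D)" by simp
  also have "of_int D = (a * (\<alpha> - \<beta>)) * (of_int (u 1) - \<alpha> * of_int (u 0))"
    unfolding of_int_D init by (simp add: power2_eq_square algebra_simps)
  also have "cmod \<dots> = (cmod a * cmod (\<alpha> - \<beta>)) * cmod (of_int (u 1) - \<alpha> * of_int (u 0))"
    by (simp add: norm_mult)
  also have "\<dots> \<le> (cmod a * (4 * B)) * (3 * B\<^sup>2)"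
  proof (intro mult_mono mult_left_mono)
    show "cmod (\<alpha> - \<beta>) \<le> 4 * B"
      using norm_triangle_ineq4[of \<alpha> \<beta>] A dominant by linarith
    have "cmod (of_int (u 1) - \<alpha> * of_int (u 0)) \<le> cmod (of_int (u 1)) + cmod (\<alpha> * of_int (u 0))"
      by (rule norm_triangle_ineq4)
    also have "\<dots> = \<bar>real_of_int (u 1)\<bar> + cmod \<alpha> * \<bar>real_of_int (u 0)\<bar>" by (simp add: norm_mult)
    also have "\<dots> \<le> B + 2 * B * B" using A B by (intro add_mono mult_mono) auto
    also have "\<dots> \<le> B\<^sup>2 + 2 * B * B" using B(1) by (simp add: self_le_power)
    finally show "cmod (of_int (u 1) - \<alpha> * of_int (u 0)) \<le> 3 * B\<^sup>2" by (simp add: power2_eq_square)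
  qed (use B in auto)
  also have "\<dots> = cmod a * (12 * B ^ 3)" by (simp add: power2_eq_square power3_eq_cube)
  finally show ?thesis using B(1) by (simp add: divide_le_eq)
qed

section \<open>Comparison of logarithms\<close>

text \<open>Logarithms of both sides of the divisibility in \<open>RJ\<close>: the terms kept
  contribute l n up to the error E each, the divisors \<open>T d\<close> about l d each. Everything
  of lower order is collected on the right.\<close>

lemma quadratic_inequality:
  assumes R: "R \<subseteq> {c<..c + M}"
    and RJ: "\<And>J. J \<subseteq> {n \<in> {c<..c + M}. u n \<noteq> 0} - R \<Longrightarrow>
      (\<Prod>n\<in>J. w n) dvd (\<Prod>d=1..<M. D\<^sup>2 * T d) * (D ^ 4 * s') ^ card J"
    and Z: "Z = {n \<in> {c<..c + M}. 2 * cmod \<alpha> ^ K * \<bar>real_of_int (u n)\<bar> < cmod a * cmod \<alpha> ^ n}"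
    and E: "E \<ge> 2 * real K * ln (cmod \<alpha>) + 2 - 2 * ln (cmod a)" "E \<ge> 0"
  shows "l * ((real (c + M) - real (card (R \<union> Z)))\<^sup>2 - (real c)\<^sup>2 - (real M)\<^sup>2) / 2
    \<le> real M * (E + 6 * ln \<bar>real_of_int D\<bar> + ln \<bar>real_of_int s'\<bar> + 2 * ln (real (c + M)))"
proof -
  \<comment> \<open>Indices outside Z have nonzero terms, because the lower bound there is positive;
    so J is admissible in \<open>RJ\<close>.\<close>
  define J where "J = {c<..c + M} - (R \<union> Z)"
  have lD: "ln \<bar>real_of_int D\<bar> \<ge> 0" "ln \<bar>real_of_int s'\<bar> \<ge> 0"
    using D_nz s'_nz by (simp_all add: ln_ge_zero Ints_nonzero_abs_ge1)
  have l0: "l \<ge> 0" using l_ge norm_ge_1 by (smt (verit) divide_nonneg_nonneg)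
  have finJ: "finite J" by (simp add: J_def)
  have "card J \<le> card {c<..c + M}" unfolding J_def by (intro card_mono) auto
  then have cJ: "card J \<le> M" by simp
  have a0: "cmod a * cmod \<alpha> ^ n > 0" for n using coeffs_nz roots_nz by simp
  have Jn: "n \<ge> 1" "cmod a * cmod \<alpha> ^ n \<le> 2 * cmod \<alpha> ^ K * \<bar>real_of_int (u n)\<bar>" "u n \<noteq> 0"
    if "n \<in> J" for n
    using that a0[of n] by (force simp: J_def Z not_less)+
  have J: "J \<subseteq> {n \<in> {c<..c + M}. u n \<noteq> 0} - R"
    using Jn(3) by (auto simp: J_def)
  have wJ: "w n \<noteq> 0" if "n \<in> J" for n using w_nz Jn that by blast
  let ?X = "\<Prod>d=1..<M. D\<^sup>2 * T d"
  have X0: "?X \<noteq> 0" using D_nz T_nz by auto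
  have "\<bar>\<Prod>n\<in>J. w n\<bar> \<le> \<bar>?X * (D ^ 4 * s') ^ card J\<bar>"
    using RJ[OF J] X0 D_nz s'_nz by (intro dvd_imp_le_int) auto
  then have "real_of_int \<bar>\<Prod>n\<in>J. w n\<bar> \<le> real_of_int \<bar>?X * (D ^ 4 * s') ^ card J\<bar>"
    by (simp only: of_int_le_iff)
  then have le: "(\<Prod>n\<in>J. \<bar>real_of_int (w n)\<bar>)
      \<le> (\<Prod>d=1..<M. \<bar>real_of_int D\<bar>\<^sup>2 * \<bar>real_of_int (T d)\<bar>)
        * (\<bar>real_of_int D\<bar> ^ 4 * \<bar>real_of_int s'\<bar>) ^ card J"
    by (simp add: abs_mult abs_prod power_abs)
  have "l * ((real (c + M) - real (card (R \<union> Z)))\<^sup>2 - (real c)\<^sup>2) / 2 - real M * E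
      \<le> l * (\<Sum>n\<in>J. real n) - real (card J) * E"
  proof (intro diff_mono mult_right_mono)
    have "(real (c + M) - real (card (R \<union> Z)))\<^sup>2 - (real c)\<^sup>2 \<le> 2 * (\<Sum>n\<in>J. real n)"
      unfolding J_def using R Z by (intro sum_Diff_ge) auto
    then show "l * ((real (c + M) - real (card (R \<union> Z)))\<^sup>2 - (real c)\<^sup>2) / 2 \<le> l * (\<Sum>n\<in>J. real n)"
      using mult_left_mono[OF _ l0] by force
  qed (use E cJ in auto)
  also have "\<dots> = (\<Sum>n\<in>J. real n * l - E)"
    by (simp add: sum_subtractf sum_distrib_left mult.commute[of l])
  also have "\<dots> \<le> (\<Sum>n\<in>J. ln \<bar>real_of_int (w n)\<bar>)"
  proof (rule sum_mono)
    fix n assume n: "n \<in> J"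
    show "real n * l - E \<le> ln \<bar>real_of_int (w n)\<bar>"
      using ln_w_ge[OF Jn(1,2)[OF n]] E(1) by linarith
  qed
  also have "\<dots> = ln (\<Prod>n\<in>J. \<bar>real_of_int (w n)\<bar>)"
    using wJ finJ by (subst ln_prod) auto
  also have "\<dots> \<le> ln ((\<Prod>d=1..<M. \<bar>real_of_int D\<bar>\<^sup>2 * \<bar>real_of_int (T d)\<bar>)
        * (\<bar>real_of_int D\<bar> ^ 4 * \<bar>real_of_int s'\<bar>) ^ card J)"
    using le wJ by (intro ln_mono prod_pos) auto
  also have "\<dots> = (\<Sum>d=1..<M. 2 * ln \<bar>real_of_int D\<bar> + ln \<bar>real_of_int (T d)\<bar>)
      + real (card J) * (4 * ln \<bar>real_of_int D\<bar> + ln \<bar>real_of_int s'\<bar>)"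
  proof -
    have "ln (\<bar>real_of_int D\<bar>\<^sup>2 * \<bar>real_of_int (T d)\<bar>) = 2 * ln \<bar>real_of_int D\<bar> + ln \<bar>real_of_int (T d)\<bar>"
      if "d \<ge> 1" for d
    proof -
      have "ln (\<bar>real_of_int D\<bar>\<^sup>2) = 2 * ln \<bar>real_of_int D\<bar>" using D_nz by (subst ln_realpow) auto
      then show ?thesis using D_nz T_nz[OF that] by (subst ln_mult) auto
    qed
    then have "ln (\<Prod>d=1..<M. \<bar>real_of_int D\<bar>\<^sup>2 * \<bar>real_of_int (T d)\<bar>)
        = (\<Sum>d=1..<M. 2 * ln \<bar>real_of_int D\<bar> + ln \<bar>real_of_int (T d)\<bar>)"
      using D_nz T_nz by (subst ln_prod) (auto intro!: sum.cong)
    moreover have "ln ((\<bar>real_of_int D\<bar> ^ 4 * \<bar>real_of_int s'\<bar>) ^ card J)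
        = real (card J) * (4 * ln \<bar>real_of_int D\<bar> + ln \<bar>real_of_int s'\<bar>)"
    proof -
      have "ln (\<bar>real_of_int D\<bar> ^ 4) = 4 * ln \<bar>real_of_int D\<bar>" using D_nz by (subst ln_realpow) auto
      then have "ln (\<bar>real_of_int D\<bar> ^ 4 * \<bar>real_of_int s'\<bar>) = 4 * ln \<bar>real_of_int D\<bar> + ln \<bar>real_of_int s'\<bar>"
        using D_nz s'_nz by (subst ln_mult) auto
      then show ?thesis using D_nz s'_nz by (subst ln_realpow) auto
    qed
    moreover have "(\<Prod>d=1..<M. \<bar>real_of_int D\<bar>\<^sup>2 * \<bar>real_of_int (T d)\<bar>) > 0"
      using D_nz T_nz by (intro prod_pos) auto
    moreover have "(\<bar>real_of_int D\<bar> ^ 4 * \<bar>real_of_int s'\<bar>) ^ card J > 0"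
      using D_nz s'_nz by simp
    ultimately show ?thesis by (simp add: ln_mult_pos)
  qed
  also have "\<dots> \<le> (\<Sum>d=1..<M. 2 * ln \<bar>real_of_int D\<bar> + 2 * ln (real (c + M)) + real d * l)
      + real M * (4 * ln \<bar>real_of_int D\<bar> + ln \<bar>real_of_int s'\<bar>)"
  proof (rule add_mono[OF sum_mono mult_right_mono])
    fix d assume d: "d \<in> {1..<M}"
    have "ln \<bar>real_of_int (T d)\<bar> \<le> 2 * ln (real d) + (real d - 1) * l" using d by (intro ln_T_le) auto
    moreover have "ln (real d) \<le> ln (real (c + M))" using d by (intro ln_mono) auto
    moreover have "(real d - 1) * l \<le> real d * l" using l0 by (intro mult_right_mono) auto
    ultimately show "2 * ln \<bar>real_of_int D\<bar> + ln \<bar>real_of_int (T d)\<bar>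
        \<le> 2 * ln \<bar>real_of_int D\<bar> + 2 * ln (real (c + M)) + real d * l" by linarith
  qed (use lD cJ in auto)
  also have "\<dots> \<le> real M * (2 * ln \<bar>real_of_int D\<bar> + 2 * ln (real (c + M))) + (real M)\<^sup>2 / 2 * l
      + real M * (4 * ln \<bar>real_of_int D\<bar> + ln \<bar>real_of_int s'\<bar>)"
  proof -
    have "(\<Sum>d=1..<M. real d) \<le> (real M)\<^sup>2 / 2"
      by (induction M) (auto simp: power2_eq_square field_simps)
    then have "(\<Sum>d=1..<M. real d * l) \<le> (real M)\<^sup>2 / 2 * l"
      unfolding sum_distrib_right[symmetric] using l0 by (intro mult_right_mono)
    moreover have "real (M - 1) * (2 * ln \<bar>real_of_int D\<bar> + 2 * ln (real (c + M)))
        \<le> real M * (2 * ln \<bar>real_of_int D\<bar> + 2 * ln (real (c + M)))"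
      using lD(1) by (cases "M = 0") (auto intro!: mult_right_mono)
    ultimately show ?thesis by (simp add: sum.distrib)
  qed
  finally show ?thesis by (simp add: field_simps)
qed

text \<open>One parameter B bounds the data and sets the slack 1/B. If the claim fails, the
  quadratic main term is at least of order N^2 / B^2, while the errors are at most of order B^3 N
  sqrt N; this forces N to be of order at most B^10.\<close>

lemma omega_bound:
  fixes B N :: nat
  assumes B: "B \<ge> 1" and r: "\<bar>r\<bar> \<le> int B" and s: "\<bar>s\<bar> \<le> int B"
    and u0: "\<bar>u 0\<bar> \<le> int B" and u1: "\<bar>u 1\<bar> \<le> int B"
    and N: "N > 1000000 * B ^ 10"
  shows "real (omega (\<Prod>n\<in>{n\<in>{1..N}. u n \<noteq> 0}. u n)) > (1 - 1 / sqrt 2 - 1 / real B) * real N"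
proof (rule ccontr)
  define t' where "t' = omega (\<Prod>n\<in>{n\<in>{1..N}. u n \<noteq> 0}. u n)"
  assume "\<not> ?thesis"
  then have small: "real t' \<le> (1 - 1 / sqrt 2 - 1 / real B) * real N" by (simp add: t'_def)
  define x y where "x = real B" and "y = real N"
  have x1: "x \<ge> 1" using B by (simp add: x_def)
  have bounds: "\<bar>real_of_int r\<bar> \<le> x" "\<bar>real_of_int s\<bar> \<le> x"
    "\<bar>real_of_int (u 0)\<bar> \<le> x" "\<bar>real_of_int (u 1)\<bar> \<le> x"
    using r s u0 u1 unfolding x_def by linarith+
  have "real (1000000 * B ^ 10) < real N" using N by (simp only: of_nat_less_iff)
  then have yx: "y > 1000000 * x ^ 10" by (simp add: x_def y_def)
  have xpow: "x ^ i \<le> x ^ j" if "i \<le> j" for i j using x1 that by (rule power_increasing[rotated])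
  have x10: "1 \<le> x ^ 10" "x \<le> x ^ 10" "x ^ 3 \<le> x ^ 10" "x\<^sup>2 \<le> x ^ 3" "x \<le> x ^ 3" "1 \<le> x ^ 3"
    using xpow[of 0 10] xpow[of 1 10] xpow[of 3 10] xpow[of 2 3] xpow[of 1 3] xpow[of 0 3] by simp_all
  \<comment> \<open>Halving minimises c^2 + M^2. With K = 8 B the small terms number at most N / (4
    B), a quarter of the slack N / B.\<close>
  define M c K where "M = N div 2" and "c = N - M" and "K = 8 * B"
  have N_eq: "c + M = N" by (simp add: c_def M_def)
  have cM: "c = M \<or> c = Suc M" unfolding c_def M_def by linarith
  have A: "1 \<le> cmod \<alpha>" "cmod \<alpha> \<le> x + 1" using norm_ge_1 norm_root_le bounds x1 by auto
  have absD: "\<bar>real_of_int D\<bar> \<le> 3 * x ^ 3" using abs_D_le[OF x1] bounds by simp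
  define S where "S = {n \<in> {c<..c + M}. u n \<noteq> 0}"
  have "2 * real c \<ge> y" using cM N_eq unfolding y_def by linarith
  moreover have "real (2 * nat \<bar>D\<bar>) = 2 * \<bar>real_of_int D\<bar>" by simp
  ultimately have "real (2 * nat \<bar>D\<bar>) \<le> real c" using absD yx x10 by linarith
  then have cD: "2 * nat \<bar>D\<bar> \<le> c" by (simp only: of_nat_le_iff)
  have S: "S \<subseteq> {c<..c + M}" "\<And>n. n \<in> S \<Longrightarrow> u n \<noteq> 0" by (auto simp: S_def)
  obtain R where R: "R \<subseteq> S" "card R \<le> card (prime_factors (\<Prod>n\<in>S. u n))"
    "\<And>J. J \<subseteq> S - R \<Longrightarrow>
      (\<Prod>n\<in>J. w n) dvd (\<Prod>d=1..<M. D\<^sup>2 * T d) * (D ^ 4 * s') ^ card J"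
    using prod_w_dvd[OF S cD] by blast
  define Z where "Z = {n \<in> {c<..c + M}. 2 * cmod \<alpha> ^ K * \<bar>real_of_int (u n)\<bar> < cmod a * cmod \<alpha> ^ n}"
  have "card Z \<le> Suc (M div K)"
  proof (rule card_le_of_separated)
    show "Z \<subseteq> {c<..c + M}" by (auto simp: Z_def)
    show "K \<ge> 1" using B by (simp add: K_def)
    show "\<And>n m. n \<in> Z \<Longrightarrow> m \<in> Z \<Longrightarrow> n < m \<Longrightarrow> K \<le> m - n"
      unfolding Z_def using small_terms_separated[of K] by blast
  qed
  moreover have "real (M div K) \<le> real M / real K" by (rule of_nat_div_le_of_nat)
  moreover have "real M / real K \<le> y / (8 * x)"
    unfolding K_def x_def y_def using B N_eq by (simp add: divide_right_mono)
  moreover have "1 \<le> y / (8 * x)" using yx x10 x1 by (simp add: le_divide_eq)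
  ultimately have cZ: "real (card Z) \<le> y / (4 * x)" by (simp add: field_simps)
  have "card R \<le> t'"
  proof -
    have "(\<Prod>n\<in>S. u n) dvd (\<Prod>n\<in>{n\<in>{1..N}. u n \<noteq> 0}. u n)"
      using N_eq by (intro prod_dvd_prod_subset) (auto simp: S_def)
    then have "prime_factors (\<Prod>n\<in>S. u n) \<subseteq> prime_factors (\<Prod>n\<in>{n\<in>{1..N}. u n \<noteq> 0}. u n)"
      by (intro dvd_prime_factors) auto
    then have "card (prime_factors (\<Prod>n\<in>S. u n)) \<le> t'"
      unfolding t'_def omega_def by (intro card_mono) auto
    then show ?thesis using R(2) by simp
  qed
  then have RZ: "real (card (R \<union> Z)) \<le> real t' + y / (4 * x)"
    using cZ card_Un_le[of R Z] by linarith
  define z where "z = real (card (R \<union> Z))"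
  define q where "q = 1 / sqrt 2"
  have q2: "q\<^sup>2 = 1 / 2" by (simp add: q_def power_divide)
  \<comment> \<open>Makes the cross term 2 q (3 / (4 x)) of the later square at least 1 / x.\<close>
  have q: "q \<ge> 2 / 3"
    by (rule power2_le_imp_le) (simp_all add: q2 power_divide, simp add: q_def)
  have y0: "y > 0" using yx x10 by linarith
  have "y - z \<ge> y * (q + 3 / (4 * x))"
  proof -
    define h where "h = y / (4 * x)"
    have "real t' \<le> (1 - q - 1 / x) * y" using small by (simp add: q_def x_def y_def)
    also have "\<dots> = y - q * y - y / x" by (simp add: left_diff_distrib)
    also have "y / x = 4 * h" by (simp add: h_def)
    finally have "real t' \<le> y - q * y - 4 * h" .
    moreover have "z \<le> real t' + h" using RZ by (simp add: z_def h_def)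
    moreover have "y * (q + 3 / (4 * x)) = q * y + 3 * h" by (simp add: h_def algebra_simps)
    ultimately show ?thesis by linarith
  qed
  then have "(y - z)\<^sup>2 \<ge> (y * (q + 3 / (4 * x)))\<^sup>2"
    using y0 q x1 by (intro power_mono) auto
  moreover have "(y * (q + 3 / (4 * x)))\<^sup>2 \<ge> y\<^sup>2 * (1 / 2 + 1 / x)"
  proof -
    have "(q + 3 / (4 * x))\<^sup>2 = q\<^sup>2 + q * (3 / 2) / x + (3 / (4 * x))\<^sup>2"
      by (simp add: power2_sum)
    moreover have "q * (3 / 2) / x \<ge> 1 / x" using q x1 by (intro divide_right_mono) auto
    moreover have "(3 / (4 * x))\<^sup>2 \<ge> 0" by simp
    ultimately have "1 / 2 + 1 / x \<le> (q + 3 / (4 * x))\<^sup>2" unfolding q2 by linarith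
    then show ?thesis unfolding power_mult_distrib by (intro mult_left_mono) auto
  qed
  ultimately have yz: "(y - z)\<^sup>2 \<ge> y\<^sup>2 / 2 + y\<^sup>2 / x" by (simp add: algebra_simps)
  \<comment> \<open>The extra 1/2 covers odd N, where c = M + 1.\<close>
  have "(real c)\<^sup>2 + (real M)\<^sup>2 \<le> y\<^sup>2 / 2 + 1 / 2"
    using cM N_eq unfolding y_def by (auto simp: power2_eq_square field_simps)
  moreover have "y\<^sup>2 / x \<ge> 1"
  proof -
    have "x * 1 \<le> y * y" using yx x10 by (intro mult_mono) auto
    then show ?thesis using x1 by (simp add: le_divide_eq power2_eq_square)
  qed
  ultimately have main: "(y - z)\<^sup>2 - (real c)\<^sup>2 - (real M)\<^sup>2 \<ge> y\<^sup>2 / (2 * x)"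
  proof -
    have "y\<^sup>2 / (2 * x) = y\<^sup>2 / x / 2" by simp
    then show ?thesis using yz \<open>y\<^sup>2 / x \<ge> 1\<close> \<open>(real c)\<^sup>2 + (real M)\<^sup>2 \<le> y\<^sup>2 / 2 + 1 / 2\<close> by linarith
  qed
  \<comment> \<open>The summand 16 x^2 bounds 2 K ln |\<alpha>|, and 24 x^3 bounds -2 ln
    |a|.\<close>
  define E where "E = 16 * x\<^sup>2 + 2 + 24 * x ^ 3"
  have lnA: "ln (cmod \<alpha>) \<le> x" using A ln_le_minus_one[of "cmod \<alpha>"] by linarith
  have lna: "- ln (cmod a) \<le> 12 * x ^ 3"
  proof -
    have "- ln (cmod a) = ln (1 / cmod a)" using coeffs_nz by (simp add: ln_div)
    also have "\<dots> \<le> 1 / cmod a" using ln_bound[of "1 / cmod a"] coeffs_nz by simp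
    also have "\<dots> \<le> 12 * x ^ 3"
      using norm_coeff_ge[OF x1] bounds x1 coeffs_nz by (simp add: field_simps)
    finally show ?thesis .
  qed
  have "2 * real K * ln (cmod \<alpha>) \<le> 2 * real K * x" using lnA by (intro mult_left_mono) auto
  also have "\<dots> = 16 * x\<^sup>2" by (simp add: K_def x_def power2_eq_square)
  finally have E: "E \<ge> 2 * real K * ln (cmod \<alpha>) + 2 - 2 * ln (cmod a)"
    using lna unfolding E_def by linarith
  have E0: "E \<ge> 0" using x1 by (simp add: E_def)
  have lnD: "ln \<bar>real_of_int D\<bar> \<le> 3 * x ^ 3"
    using ln_bound[of "\<bar>real_of_int D\<bar>"] absD D_nz by simp
  have lns: "ln \<bar>real_of_int s'\<bar> \<le> x"
  proof -
    have "\<bar>s'\<bar> \<le> \<bar>s\<bar>" 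
    proof (rule dvd_imp_le_int[OF s_nz])
      have "s' dvd g * s'" by simp
      then show "s' dvd s" by (simp only: s_eq[symmetric])
    qed
    then have "\<bar>real_of_int s'\<bar> \<le> x" using bounds(2) by linarith
    then show ?thesis using ln_bound[of "\<bar>real_of_int s'\<bar>"] s'_nz by simp
  qed
  have lny: "ln y \<le> 2 * sqrt y"
  proof -
    have "ln y = 2 * ln (sqrt y)" using y0 by (simp add: ln_sqrt)
    then show ?thesis using ln_bound[of "sqrt y"] y0 by simp
  qed
  have sy: "sqrt y \<ge> 1" using yx x10 by simp
  have "R \<subseteq> {c<..c + M}" using R(1) by (auto simp: S_def)
  from quadratic_inequality[OF this R(3)[unfolded S_def] Z_def E E0]
  have "l * ((y - z)\<^sup>2 - (real c)\<^sup>2 - (real M)\<^sup>2) / 2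
    \<le> real M * (E + 6 * ln \<bar>real_of_int D\<bar> + ln \<bar>real_of_int s'\<bar> + 2 * ln y)"
    unfolding N_eq y_def z_def .
  also have "\<dots> \<le> real M * (65 * x ^ 3 * sqrt y)"
  proof (rule mult_left_mono)
    \<comment> \<open>61 = 42 + 18 + 1 for the three summands; 2 ln y \<le> 4 sqrt y raises it to
      65.\<close>
    have "E + 6 * ln \<bar>real_of_int D\<bar> + ln \<bar>real_of_int s'\<bar> \<le> 61 * x ^ 3"
      unfolding E_def using lnD lns x10 by linarith
    also have "\<dots> \<le> 61 * x ^ 3 * sqrt y"
      using mult_left_mono[OF sy, of "61 * x ^ 3"] x1 by simp
    finally have "E + 6 * ln \<bar>real_of_int D\<bar> + ln \<bar>real_of_int s'\<bar> \<le> 61 * x ^ 3 * sqrt y" .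
    moreover have "1 * sqrt y \<le> x ^ 3 * sqrt y" using x10 y0 by (intro mult_right_mono) auto
    ultimately show "E + 6 * ln \<bar>real_of_int D\<bar> + ln \<bar>real_of_int s'\<bar> + 2 * ln y
        \<le> 65 * x ^ 3 * sqrt y" using lny by linarith
  qed simp
  also have "\<dots> \<le> y * (65 * x ^ 3 * sqrt y)"
    using N_eq x1 y0 unfolding y_def by (intro mult_right_mono) auto
  finally have up: "l * ((y - z)\<^sup>2 - (real c)\<^sup>2 - (real M)\<^sup>2) / 2 \<le> y * (65 * x ^ 3 * sqrt y)" .
  have "1 / (3 * x) \<le> 1 / (cmod \<alpha> + 1)" using A x1 by (intro divide_left_mono) auto
  then have l3: "1 / (3 * x) \<le> l" using l_ge by linarith
  have "1 / (3 * x) * (y\<^sup>2 / (2 * x)) \<le> l * ((y - z)\<^sup>2 - (real c)\<^sup>2 - (real M)\<^sup>2)"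
    using l3 main x1 y0 by (intro mult_mono) (auto intro: order_trans[of 0 "1 / (3 * x)" l])
  then have "1 / (3 * x) * (y\<^sup>2 / (2 * x)) \<le> 2 * (y * (65 * x ^ 3 * sqrt y))"
    using up by linarith
  \<comment> \<open>780 = 2 * 65 * 6, with 6 from the two denominators; its square 608400 is below
    the factor 1000000 of the threshold.\<close>
  then have "y * (sqrt y * sqrt y) \<le> y * (780 * x ^ 5 * sqrt y)"
    using x1 y0 by (simp add: field_simps power2_eq_square power3_eq_cube power_numeral_reduce)
  then have "sqrt y * sqrt y \<le> 780 * x ^ 5 * sqrt y" using y0 by (rule mult_left_le_imp_le)
  then have "sqrt y \<le> 780 * x ^ 5" by (rule mult_right_le_imp_le) (use y0 in simp)
  then have "(sqrt y)\<^sup>2 \<le> (780 * x ^ 5)\<^sup>2" using y0 by (intro power_mono) auto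
  then have "y \<le> 608400 * x ^ 10" using y0 by (simp add: power_mult_distrib flip: power_mult)
  then show False using yx x10(1) by linarith
qed

end

section \<open>From the stated data to an ordered pair of roots\<close>

lemma dominant_recurrence_cases:
  fixes r s :: int and u :: "nat \<Rightarrow> int" and \<alpha> \<beta> a b :: complex
  assumes disc: "r\<^sup>2 + 4 * s \<noteq> 0"
    and rec: "\<forall>n\<ge>2. u n = r * u (n - 1) + s * u (n - 2)"
    and roots: "{x::complex. x\<^sup>2 - of_int r * x - of_int s = 0} = {\<alpha>, \<beta>}"
    and a: "a = (of_int (u 0) * \<beta> - of_int (u 1)) / (\<beta> - \<alpha>)"
    and b: "b = (of_int (u 1) - of_int (u 0) * \<alpha>) / (\<beta> - \<alpha>)"
    and nd: "nondegenerate a b \<alpha> \<beta>"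
  shows "dominant_recurrence r s u \<alpha> \<beta> a b \<or> dominant_recurrence r s u \<beta> \<alpha> b a"
proof -
  have root: "x\<^sup>2 - of_int r * x - of_int s = 0 \<longleftrightarrow> x = \<alpha> \<or> x = \<beta>" for x :: complex
    using roots by blast
  have ra: "\<alpha>\<^sup>2 - of_int r * \<alpha> - of_int s = 0" and rb: "\<beta>\<^sup>2 - of_int r * \<beta> - of_int s = 0"
    using root by auto
  have neq: "\<alpha> \<noteq> \<beta>"
  proof
    assume eq: "\<alpha> = \<beta>"
    \<comment> \<open>With \<alpha> also r - \<alpha> is a root; if there is only one root, then r =
      2 \<alpha> and s = -\<alpha>^2, so the discriminant vanishes.\<close>
    have "(of_int r - \<alpha>)\<^sup>2 - of_int r * (of_int r - \<alpha>) - of_int s = \<alpha>\<^sup>2 - of_int r * \<alpha> - of_int s"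
      by (simp add: power2_eq_square algebra_simps)
    then have "of_int r - \<alpha> = \<alpha>" using ra root eq by metis
    then have r: "of_int r = 2 * \<alpha>" by (simp add: algebra_simps)
    then have "of_int s = - (\<alpha>\<^sup>2)" using ra by (simp add: power2_eq_square algebra_simps)
    then have "(of_int (r\<^sup>2 + 4 * s) :: complex) = 0" using r by (simp add: power_mult_distrib)
    then show False using disc by (simp only: of_int_eq_0_iff)
  qed
  have "(\<alpha> - \<beta>) * (\<alpha> + \<beta> - of_int r)
      = (\<alpha>\<^sup>2 - of_int r * \<alpha> - of_int s) - (\<beta>\<^sup>2 - of_int r * \<beta> - of_int s)"
    by (simp add: power2_eq_square algebra_simps)
  then have sm: "\<alpha> + \<beta> = of_int r" using ra rb neq by simp
  have "\<alpha> * \<beta> = \<alpha> * (of_int r - \<alpha>)" using sm by (simp flip: sm)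
  also have "\<dots> = - of_int s" using ra by (simp add: power2_eq_square algebra_simps)
  finally have pr: "\<alpha> * \<beta> = - of_int s" .
  have nz: "a \<noteq> 0" "b \<noteq> 0" "\<alpha> \<noteq> 0" "\<beta> \<noteq> 0" using nd by (auto simp: nondegenerate_def)
  have nr: "\<alpha> ^ k \<noteq> \<beta> ^ k" if "k > 0" for k
  proof
    assume "\<alpha> ^ k = \<beta> ^ k"
    then have "(\<alpha> / \<beta>) ^ k = 1" using nz by (simp add: power_divide)
    then show False using nd that unfolding nondegenerate_def by blast
  qed
  have ba: "\<beta> - \<alpha> \<noteq> 0" using neq by simp
  have "a + b = of_int (u 0) * (\<beta> - \<alpha>) / (\<beta> - \<alpha>)"
    unfolding a b by (simp add: add_divide_distrib[symmetric] algebra_simps)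
  then have i0: "of_int (u 0) = a + b" using ba by simp
  have "a * \<alpha> + b * \<beta> = of_int (u 1) * (\<beta> - \<alpha>) / (\<beta> - \<alpha>)"
    unfolding a b by (simp add: add_divide_distrib[symmetric] algebra_simps)
  then have i1: "of_int (u 1) = a * \<alpha> + b * \<beta>" using ba by simp
  have rec': "u (Suc (Suc n)) = r * u (Suc n) + s * u n" for n
    using rec[rule_format, of "Suc (Suc n)"] by simp
  show ?thesis
  proof (cases "cmod \<beta> \<le> cmod \<alpha>")
    case True
    have "dominant_recurrence r s u \<alpha> \<beta> a b"
      using rec' sm pr neq True nz nr i0 i1 by unfold_locales auto
    then show ?thesis ..
  next
    case False
    have "dominant_recurrence r s u \<beta> \<alpha> b a"
    proof unfold_locales
      show "\<And>k. k > 0 \<Longrightarrow> \<beta> ^ k \<noteq> \<alpha> ^ k" using nr by metis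
    qed (use rec' sm pr neq False nz i0 i1 in \<open>auto simp: ac_simps\<close>)
    then show ?thesis ..
  qed
qed

theorem theorem2p1:
  "\<exists>C :: int \<Rightarrow> int \<Rightarrow> int \<Rightarrow> int \<Rightarrow> nat \<Rightarrow> nat \<Rightarrow> nat.
     effectively_computable C \<and>
     (\<forall>(r::int) (s::int) (u :: nat \<Rightarrow> int) (\<alpha>::complex) (\<beta>::complex) (a::complex) (b::complex)
        (\<epsilon>::real) (p::nat) (q::nat).
        r\<^sup>2 + 4 * s \<noteq> 0 \<longrightarrow>
        (\<forall>n\<ge>2. u n = r * u (n - 1) + s * u (n - 2)) \<longrightarrow>
        {x::complex. x\<^sup>2 - of_int r * x - of_int s = 0} = {\<alpha>, \<beta>} \<longrightarrow>
        a = (of_int (u 0) * \<beta> - of_int (u 1)) / (\<beta> - \<alpha>) \<longrightarrow>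
        b = (of_int (u 1) - of_int (u 0) * \<alpha>) / (\<beta> - \<alpha>) \<longrightarrow>
        nondegenerate a b \<alpha> \<beta> \<longrightarrow>
        \<epsilon> > 0 \<longrightarrow>
        p > 0 \<longrightarrow> q > 0 \<longrightarrow> real p / real q \<le> \<epsilon> \<longrightarrow>
        C r s (u 0) (u 1) p q > 0 \<and>
        (\<forall>N::nat. N > C r s (u 0) (u 1) p q \<longrightarrow>
           real (omega (\<Prod>n\<in>{n\<in>{1..N}. u n \<noteq> 0}. u n)) >
             (1 - 1 / sqrt 2 - \<epsilon>) * real N))"
proof -
  \<comment> \<open>The sum of the codes, p, q and 1 dominates |r|, |s|, |u(0)|, |u(1)| and q at
    once, so it serves as B.\<close>
  define h :: "nat list \<Rightarrow> nat"
    where "h xs = xs ! 0 + xs ! 1 + xs ! 2 + xs ! 3 + xs ! 4 + xs ! 5 + 1" for xs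
  define C where "C r s u0 u1 p q =
      1000000 * h [int_encode r, int_encode s, int_encode u0, int_encode u1, p, q] ^ 10"
    for r s u0 u1 p q
  have "general_recursive 6 h"
    unfolding h_def
    by (intro general_recursive_add general_recursive_const general_recursive.proj) auto
  then have "general_recursive 6 (\<lambda>xs. 1000000 * h xs ^ 10)"
    by (intro general_recursive_mult general_recursive_const general_recursive_power)
  then have "effectively_computable C"
    unfolding effectively_computable_def C_def by blast
  moreover have "C r s (u 0) (u 1) p q > 0 \<and>
      (\<forall>N. N > C r s (u 0) (u 1) p q \<longrightarrow>
         real (omega (\<Prod>n\<in>{n\<in>{1..N}. u n \<noteq> 0}. u n)) > (1 - 1 / sqrt 2 - \<epsilon>) * real N)"
    if hyps: "r\<^sup>2 + 4 * s \<noteq> 0" "\<forall>n\<ge>2. u n = r * u (n - 1) + s * u (n - 2)"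
      "{x::complex. x\<^sup>2 - of_int r * x - of_int s = 0} = {\<alpha>, \<beta>}"
      "a = (of_int (u 0) * \<beta> - of_int (u 1)) / (\<beta> - \<alpha>)"
      "b = (of_int (u 1) - of_int (u 0) * \<alpha>) / (\<beta> - \<alpha>)"
      "nondegenerate a b \<alpha> \<beta>"
      and pq: "p > 0" "q > 0" "real p / real q \<le> \<epsilon>"
    for r s :: int and u :: "nat \<Rightarrow> int" and \<alpha> \<beta> a b :: complex and \<epsilon> :: real and p q :: nat
  proof (intro conjI allI impI)
    define B where "B = h [int_encode r, int_encode s, int_encode (u 0), int_encode (u 1), p, q]"
    have C: "C r s (u 0) (u 1) p q = 1000000 * B ^ 10" by (simp add: C_def B_def)
    have B_eq: "B = int_encode r + int_encode s + int_encode (u 0) + int_encode (u 1) + p + q + 1"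
      by (simp add: B_def h_def)
    have B: "B \<ge> 1" "B \<ge> q" by (simp_all add: B_eq)
    have bounds: "\<bar>r\<bar> \<le> int B" "\<bar>s\<bar> \<le> int B" "\<bar>u 0\<bar> \<le> int B" "\<bar>u 1\<bar> \<le> int B"
      using abs_le_int_encode[of r] abs_le_int_encode[of s] abs_le_int_encode[of "u 0"]
        abs_le_int_encode[of "u 1"] unfolding B_eq by linarith+
    show "C r s (u 0) (u 1) p q > 0" unfolding C using B(1) by simp
    fix N assume N: "N > C r s (u 0) (u 1) p q"
    \<comment> \<open>Uses q \<le> B and p \<ge> 1, so 1 / B is a lower bound for
      \<epsilon>.\<close>
    have "1 / real B \<le> real p / real q" using pq B by (intro frac_le) auto
    then have "(1 - 1 / sqrt 2 - \<epsilon>) * real N \<le> (1 - 1 / sqrt 2 - 1 / real B) * real N"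
      using pq(3) by (intro mult_right_mono) auto
    also have "\<dots> < real (omega (\<Prod>n\<in>{n\<in>{1..N}. u n \<noteq> 0}. u n))"
      using dominant_recurrence_cases[OF hyps]
        dominant_recurrence.omega_bound[OF _ B(1) bounds N[unfolded C]] by blast
    finally show "real (omega (\<Prod>n\<in>{n\<in>{1..N}. u n \<noteq> 0}. u n)) > (1 - 1 / sqrt 2 - \<epsilon>) * real N" .
  qed
  ultimately show ?thesis by blast
qed

end
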